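(* The following are provable in $\mathbf{ZF}$. Let $\mathbf{Y}=\langle Y,\tau_Y\rangle$ be a $P$-space. (i) If $\mathbf{X}$ is a $P$-space whose every point has a well-orderable base of neighborhoods, then $\mathbf{X}\times\mathbf{Y}$ is a $P$-space. In particular, if $\mathbf{X}$ is a first-countable $P$-space, then $\mathbf{X}\times\mathbf{Y}$ is a $P$-space. (ii) If $\mathbf{X}$ is a base-hereditarily Lindelöf $P$-space, then $\mathbf{X}\times\mathbf{Y}$ is a $P$-space. (iii) If $X$ is an infinite quasi Dedekind-finite set, and $\infty$ is an element with $\infty\notin X$, then both $\mathbf{X}_{cof}\times\mathbf{Y}$ and $\mathbf{X}(\infty)\times\mathbf{Y}$ are $P$-spaces.
   Context: The base theory is $\mathbf{ZF}$ (no Axiom of Choice). A set is countable if it is equipotent to a subset of $\omega$. A set is Dedekind-infinite if it is equipotent to a proper subset of itself. A set $X$ is quasi Dedekind-finite if the set $[X]^{<\omega}$ of its finite subsets is not Dedekind-infinite. A topological space is a $P$-space if all its $G_\delta$-sets are open (no separation axioms assumed). A topological space $\mathbf{X}$ is base-hereditarily Lindelöf if it has a base $\mathcal{B}$ such that, for every $B\in\mathcal{B}$ and every family $\mathcal{G}\subseteq\mathcal{B}$ with $B\subseteq\bigcup\mathcal{G}$, there exists a countable $\mathcal{H}\subseteq\mathcal{G}$ with $B\subseteq\bigcup\mathcal{H}$. $\mathbf{X}_{cof}$ is the set $X$ with the cofinite topology $\{\emptyset\}\cup\{X\setminus F:F\in[X]^{<\omega}\}$. For an infinite set $X$ and $\infty\notin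 X$, $\mathbf{X}(\infty)$ is the set $X\cup\{\infty\}$ with topology $\mathcal{P}(X)\cup\{(X\cup\{\infty\})\setminus F:F\in[X]^{<\omega}\}$. *)

theory Defs
  imports Main
begin

text \<open>
  HOL proves the axiom of choice, and under choice the theorem is either trivial or (for infinite
  quasi Dedekind-finite sets) vacuous. So the sets in question are not HOL sets: they are the
  elements of an arbitrary structure \<open>(V, mem)\<close>, with \<open>V\<close> the universe of a type, that satisfies the
  first-order axioms of ZF. A statement is a theorem of ZF iff it is true in all such structures.
  This reading requires that every quantifier below that takes part in a set-theoretic notion ranges
  over \<open>V\<close>, never over HOL sets, HOL functions or HOL predicates on \<open>V\<close>.
\<close>

datatype fm = Mem nat nat | Eq nat nat | Neg fm | Conj fm fm | All nat fm

primrec sat :: "('v \<Rightarrow> 'v \<Rightarrow> bool) \<Rightarrow> (nat \<Rightarrow> 'v) \<Rightarrow> fm \<Rightarrow> bool" where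
  "sat mem s (Mem i j) \<longleftrightarrow> mem (s i) (s j)"
| "sat mem s (Eq i j) \<longleftrightarrow> s i = s j"
| "sat mem s (Neg p) \<longleftrightarrow> \<not> sat mem s p"
| "sat mem s (Conj p q) \<longleftrightarrow> sat mem s p \<and> sat mem s q"
| "sat mem s (All i p) \<longleftrightarrow> (\<forall>a. sat mem (s(i := a)) p)"

locale membership =
  fixes mem :: "'v \<Rightarrow> 'v \<Rightarrow> bool" (infix "\<epsilon>" 50)
begin

subsection \<open>Elementary set theory\<close>

definition subset :: "'v \<Rightarrow> 'v \<Rightarrow> bool" (infix "\<sqsubseteq>" 50) where
  "A \<sqsubseteq> B \<longleftrightarrow> (\<forall>x. x \<epsilon> A \<longrightarrow> x \<epsilon> B)"

text \<open>
  \<open>SET x. P x\<close> is the element of \<open>V\<close> whose members are exactly the \<open>x\<close> with \<open>P x\<close>. By extensionality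
  there is at most one. The term is meaningful only if there is one, which the axioms of ZF
  guarantee for each use below.
\<close>

definition the_set :: "('v \<Rightarrow> bool) \<Rightarrow> 'v" (binder "SET " 10) where
  "the_set P = (THE A. \<forall>x. x \<epsilon> A \<longleftrightarrow> P x)"

definition empty :: 'v where
  "empty = (SET x. False)"

definition upair :: "'v \<Rightarrow> 'v \<Rightarrow> 'v" where
  "upair a b = (SET x. x = a \<or> x = b)"

definition pair :: "'v \<Rightarrow> 'v \<Rightarrow> 'v" where
  "pair a b = upair (upair a a) (upair a b)"

definition union :: "'v \<Rightarrow> 'v \<Rightarrow> 'v" where
  "union A B = (SET x. x \<epsilon> A \<or> x \<epsilon> B)"

definition inter :: "'v \<Rightarrow> 'v \<Rightarrow> 'v" where
  "inter A B = (SET x. x \<epsilon> A \<and> x \<epsilon> B)"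

definition diff :: "'v \<Rightarrow> 'v \<Rightarrow> 'v" where
  "diff A B = (SET x. x \<epsilon> A \<and> \<not> x \<epsilon> B)"

definition bigunion :: "'v \<Rightarrow> 'v" where
  "bigunion S = (SET x. \<exists>A. A \<epsilon> S \<and> x \<epsilon> A)"

definition powerset :: "'v \<Rightarrow> 'v" where
  "powerset X = (SET A. A \<sqsubseteq> X)"

definition product :: "'v \<Rightarrow> 'v \<Rightarrow> 'v" where
  "product A B = (SET p. \<exists>a b. a \<epsilon> A \<and> b \<epsilon> B \<and> p = pair a b)"

definition adjoin :: "'v \<Rightarrow> 'v \<Rightarrow> 'v" where
  "adjoin A a = union A (upair a a)"

definition omega :: 'v where
  "omega = (SET n. \<forall>I. empty \<epsilon> I \<and> (\<forall>x. x \<epsilon> I \<longrightarrow> adjoin x x \<epsilon> I) \<longrightarrow> n \<epsilon> I)"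

subsection \<open>Cardinality and well-orderability\<close>

definition bijection :: "'v \<Rightarrow> 'v \<Rightarrow> 'v \<Rightarrow> bool" where
  "bijection f A B \<longleftrightarrow> f \<sqsubseteq> product A B
     \<and> (\<forall>a. a \<epsilon> A \<longrightarrow> (\<exists>!b. pair a b \<epsilon> f))
     \<and> (\<forall>b. b \<epsilon> B \<longrightarrow> (\<exists>!a. pair a b \<epsilon> f))"

definition equipotent :: "'v \<Rightarrow> 'v \<Rightarrow> bool" where
  "equipotent A B \<longleftrightarrow> (\<exists>f. bijection f A B)"

definition countable_set :: "'v \<Rightarrow> bool" where
  "countable_set A \<longleftrightarrow> (\<exists>B. B \<sqsubseteq> omega \<and> equipotent A B)"

definition finite_set :: "'v \<Rightarrow> bool" where
  "finite_set A \<longleftrightarrow> (\<exists>n. n \<epsilon> omega \<and> equipotent A n)"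

definition Fin :: "'v \<Rightarrow> 'v" where
  "Fin X = (SET F. F \<sqsubseteq> X \<and> finite_set F)"

definition Dedekind_infinite :: "'v \<Rightarrow> bool" where
  "Dedekind_infinite A \<longleftrightarrow> (\<exists>B. B \<sqsubseteq> A \<and> B \<noteq> A \<and> equipotent A B)"

definition quasi_Dedekind_finite :: "'v \<Rightarrow> bool" where
  "quasi_Dedekind_finite X \<longleftrightarrow> \<not> Dedekind_infinite (Fin X)"

definition well_orders :: "'v \<Rightarrow> 'v \<Rightarrow> bool" where
  "well_orders R A \<longleftrightarrow> R \<sqsubseteq> product A A
     \<and> (\<forall>x. \<not> pair x x \<epsilon> R)
     \<and> (\<forall>x y z. pair x y \<epsilon> R \<and> pair y z \<epsilon> R \<longrightarrow> pair x z \<epsilon> R)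
     \<and> (\<forall>x y. x \<epsilon> A \<and> y \<epsilon> A \<longrightarrow> x = y \<or> pair x y \<epsilon> R \<or> pair y x \<epsilon> R)
     \<and> (\<forall>B. B \<sqsubseteq> A \<and> B \<noteq> empty \<longrightarrow>
          (\<exists>m. m \<epsilon> B \<and> (\<forall>x. x \<epsilon> B \<longrightarrow> \<not> pair x m \<epsilon> R)))"

definition well_orderable :: "'v \<Rightarrow> bool" where
  "well_orderable A \<longleftrightarrow> (\<exists>R. well_orders R A)"

subsection \<open>Topology\<close>

definition topological_space :: "'v \<Rightarrow> 'v \<Rightarrow> bool" where
  "topological_space X T \<longleftrightarrow> T \<sqsubseteq> powerset X \<and> empty \<epsilon> T \<and> X \<epsilon> T
     \<and> (\<forall>U V. U \<epsilon> T \<and> V \<epsilon> T \<longrightarrow> inter U V \<epsilon> T)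
     \<and> (\<forall>S. S \<sqsubseteq> T \<longrightarrow> bigunion S \<epsilon> T)"

text \<open>The intersection of the empty family of open sets is the whole space.\<close>

definition G_delta :: "'v \<Rightarrow> 'v \<Rightarrow> 'v \<Rightarrow> bool" where
  "G_delta X T G \<longleftrightarrow> (\<exists>S. S \<sqsubseteq> T \<and> countable_set S
     \<and> G = (SET x. x \<epsilon> X \<and> (\<forall>U. U \<epsilon> S \<longrightarrow> x \<epsilon> U)))"

definition P_space :: "'v \<Rightarrow> 'v \<Rightarrow> bool" where
  "P_space X T \<longleftrightarrow> topological_space X T \<and> (\<forall>G. G_delta X T G \<longrightarrow> G \<epsilon> T)"

text \<open>Neighborhoods need not be open.\<close>

definition neighborhood :: "'v \<Rightarrow> 'v \<Rightarrow> 'v \<Rightarrow> 'v \<Rightarrow> bool" where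
  "neighborhood X T x N \<longleftrightarrow> N \<sqsubseteq> X \<and> (\<exists>U. U \<epsilon> T \<and> x \<epsilon> U \<and> U \<sqsubseteq> N)"

definition neighborhood_base :: "'v \<Rightarrow> 'v \<Rightarrow> 'v \<Rightarrow> 'v \<Rightarrow> bool" where
  "neighborhood_base X T x B \<longleftrightarrow> (\<forall>N. N \<epsilon> B \<longrightarrow> neighborhood X T x N)
     \<and> (\<forall>M. neighborhood X T x M \<longrightarrow> (\<exists>N. N \<epsilon> B \<and> N \<sqsubseteq> M))"

definition first_countable_space :: "'v \<Rightarrow> 'v \<Rightarrow> bool" where
  "first_countable_space X T \<longleftrightarrow> topological_space X T
     \<and> (\<forall>x. x \<epsilon> X \<longrightarrow> (\<exists>B. neighborhood_base X T x B \<and> countable_set B))"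

definition base :: "'v \<Rightarrow> 'v \<Rightarrow> bool" where
  "base T B \<longleftrightarrow> B \<sqsubseteq> T \<and> (\<forall>U. U \<epsilon> T \<longrightarrow> (\<exists>S. S \<sqsubseteq> B \<and> U = bigunion S))"

definition base_hereditarily_Lindelof :: "'v \<Rightarrow> 'v \<Rightarrow> bool" where
  "base_hereditarily_Lindelof X T \<longleftrightarrow> topological_space X T
     \<and> (\<exists>\<B>. base T \<B> \<and>
          (\<forall>B \<G>. B \<epsilon> \<B> \<and> \<G> \<sqsubseteq> \<B> \<and> B \<sqsubseteq> bigunion \<G> \<longrightarrow>
             (\<exists>\<H>. \<H> \<sqsubseteq> \<G> \<and> countable_set \<H> \<and> B \<sqsubseteq> bigunion \<H>)))"

definition product_topology :: "'v \<Rightarrow> 'v \<Rightarrow> 'v" where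
  "product_topology TX TY = (SET W. \<exists>S. W = bigunion S
     \<and> (\<forall>B. B \<epsilon> S \<longrightarrow> (\<exists>U V. U \<epsilon> TX \<and> V \<epsilon> TY \<and> B = product U V)))"

definition cofinite_topology :: "'v \<Rightarrow> 'v" where
  "cofinite_topology X = (SET U. U = empty \<or> (\<exists>F. F \<epsilon> Fin X \<and> U = diff X F))"

text \<open>The topology of \<open>X(\<infinity>)\<close>, whose underlying set is \<open>adjoin X p\<close> with \<open>p\<close> in the role of \<open>\<infinity>\<close>.\<close>

definition infinity_topology :: "'v \<Rightarrow> 'v \<Rightarrow> 'v" where
  "infinity_topology X p =
     union (powerset X) (SET U. \<exists>F. F \<epsilon> Fin X \<and> U = diff (adjoin X p) F)"

end

subsection \<open>Models of ZF\<close>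

text \<open>
  In the two schemas the assignment \<open>s\<close> supplies the parameters of the formula \<open>p\<close>. It is essential
  that the schemas range over formulas: with HOL predicates instead, the structure would inherit
  the axiom of choice from HOL.
\<close>

locale ZF = membership mem
  for mem :: "'v \<Rightarrow> 'v \<Rightarrow> bool" (infix "\<epsilon>" 50) +
  assumes extensionality: "(\<forall>x. x \<epsilon> A \<longleftrightarrow> x \<epsilon> B) \<Longrightarrow> A = B"
    and foundation: "x \<epsilon> A \<Longrightarrow> \<exists>y. y \<epsilon> A \<and> (\<forall>z. z \<epsilon> y \<longrightarrow> \<not> z \<epsilon> A)"
    and pairing: "\<exists>C. \<forall>x. x \<epsilon> C \<longleftrightarrow> x = a \<or> x = b"
    and union_axiom: "\<exists>C. \<forall>x. x \<epsilon> C \<longleftrightarrow> (\<exists>A. A \<epsilon> S \<and> x \<epsilon> A)"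
    and powerset_axiom: "\<exists>C. \<forall>A. A \<epsilon> C \<longleftrightarrow> (\<forall>x. x \<epsilon> A \<longrightarrow> x \<epsilon> X)"
    and infinity: "\<exists>I. (\<exists>e. e \<epsilon> I \<and> (\<forall>x. \<not> x \<epsilon> e))
      \<and> (\<forall>x. x \<epsilon> I \<longrightarrow> (\<exists>y. y \<epsilon> I \<and> (\<forall>z. z \<epsilon> y \<longleftrightarrow> z \<epsilon> x \<or> z = x)))"
    and separation: "\<exists>C. \<forall>x. x \<epsilon> C \<longleftrightarrow> x \<epsilon> A \<and> sat mem (s(0 := x)) p"
    and replacement: "(\<forall>x. x \<epsilon> A \<longrightarrow> (\<exists>!y. sat mem (s(0 := x, 1 := y)) p)) \<Longrightarrow>
      \<exists>C. \<forall>y. y \<epsilon> C \<longleftrightarrow> (\<exists>x. x \<epsilon> A \<and> sat mem (s(0 := x, 1 := y)) p)"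

end

theory Submission
  imports Defs
begin

text \<open>
  Separation and replacement are available only for formulas, so the argument runs through a class
  of definable predicates that is closed under the logical operations and under substitution of
  definable functions.

  Let a point \<open>(x, y)\<close> lie in all members \<open>W\<close> of a countable family of open subsets of the
  product. It suffices to find an open box around it inside all \<open>W\<close>. For a fixed first side \<open>B\<close>
  there is a largest open second side that fits into \<open>W\<close>, so only \<open>B\<close> has to be found without
  choice; call \<open>B\<close> good for \<open>W\<close> if that largest second side contains \<open>y\<close>. In (i), take the least
  good neighborhood of \<open>x\<close> for each \<open>W\<close> and intersect. In (ii), the union of the good base sets for
  \<open>W\<close> is an open neighborhood of \<open>x\<close>; the intersection of these unions is open and contains a base
  set \<open>B\<close> around \<open>x\<close>, and the Lindelof property shows that this single \<open>B\<close> is good for every \<open>W\<close>.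
  Part (iii) is an instance of (ii): a countable family of finite subsets of a quasi Dedekind-finite
  set is finite, and a cofinite set leaves only finitely many points to cover.
\<close>

section \<open>Definable predicates\<close>

primrec rename :: "(nat \<Rightarrow> nat) \<Rightarrow> fm \<Rightarrow> fm" where
  "rename f (Mem i j) = Mem (f i) (f j)"
| "rename f (Eq i j) = Eq (f i) (f j)"
| "rename f (Neg p) = Neg (rename f p)"
| "rename f (Conj p q) = Conj (rename f p) (rename f q)"
| "rename f (All i p) = All (f i) (rename f p)"

text \<open>The quantifier case rests on injectivity: rebinding position \<open>f i\<close> must
  leave every other position \<open>f n\<close> alone, so that no variable is captured.\<close>

lemma sat_rename: "inj f \<Longrightarrow> sat mem s (rename f p) \<longleftrightarrow> sat mem (\<lambda>n. s (f n)) p"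
proof (induction p arbitrary: s)
  case (All i p)
  have "(\<lambda>n. (s(f i := a)) (f n)) = (\<lambda>n. s (f n))(i := a)" for a
    using All.prems by (auto simp: fun_eq_iff inj_eq)
  then show ?case using All by simp
qed auto

text \<open>Even positions carry the variables, odd positions the parameters.\<close>

definition interleave :: "(nat \<Rightarrow> 'v) \<Rightarrow> (nat \<Rightarrow> 'v) \<Rightarrow> nat \<Rightarrow> 'v" where
  "interleave s r n = (if even n then s (n div 2) else r (n div 2))"

context ZF
begin

text \<open>Speaking of predicates on assignments instead of formulas lets definability be derived
  by introduction rules. Index 0 is the most recently bound variable, and \<open>r\<close> supplies
  arbitrary elements of the universe as parameters.\<close>

definition definable :: "((nat \<Rightarrow> 'v) \<Rightarrow> bool) \<Rightarrow> bool" where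
  "definable P \<longleftrightarrow> (\<exists>p r. \<forall>s. P s \<longleftrightarrow> sat mem (interleave s r) p)"

text \<open>A function counts as definable when its graph is: the value sits at index 0 and the
  arguments are moved up by one.\<close>

definition definable_fun :: "((nat \<Rightarrow> 'v) \<Rightarrow> 'v) \<Rightarrow> bool" where
  "definable_fun t \<longleftrightarrow> definable (\<lambda>s. s 0 = t (\<lambda>n. s (Suc n)))"

section \<open>Closure of definability under the logical operations\<close>

lemma definable_renameI:
  assumes "\<And>s. P s \<longleftrightarrow> sat mem (\<lambda>n. interleave s r (f n)) p" and "inj f"
  shows "definable P"
  unfolding definable_def
  by (rule exI[of _ "rename f p"], rule exI[of _ r]) (simp add: assms sat_rename)

lemma definable_reindex:
  assumes "definable P" and "inj g"
  shows "definable (\<lambda>s. P (\<lambda>n. s (g n)))"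
proof -
  obtain p r where p: "\<And>s. P s \<longleftrightarrow> sat mem (interleave s r) p"
    using assms(1) unfolding definable_def by blast
  define f where "f n = (if even n then 2 * g (n div 2) else n)" for n
  have "inj f"
    unfolding f_def inj_def using \<open>inj g\<close> by (auto simp: inj_eq elim!: evenE)
  moreover have "(\<lambda>n. interleave s r (f n)) = interleave (\<lambda>n. s (g n)) r" for s
    by (auto simp: fun_eq_iff interleave_def f_def)
  ultimately show ?thesis by (intro definable_renameI[of _ r f p]) (auto simp: p)
qed

lemma definable_mem_var: "definable (\<lambda>s. s i \<epsilon> s j)"
  unfolding definable_def
  by (rule exI[of _ "Mem (2 * i) (2 * j)"]) (simp add: interleave_def)

lemma definable_eq_var: "definable (\<lambda>s. s i = s j)"
  unfolding definable_def
  by (rule exI[of _ "Eq (2 * i) (2 * j)"]) (simp add: interleave_def)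

lemma definable_eq_const: "definable (\<lambda>s. s i = c)"
  unfolding definable_def
  by (rule exI[of _ "Eq (2 * i) 1"], rule exI[of _ "\<lambda>_. c"]) (simp add: interleave_def)

lemma definable_not: "definable P \<Longrightarrow> definable (\<lambda>s. \<not> P s)"
  unfolding definable_def by (metis sat.simps(3))

lemma definable_conj:
  assumes "definable P" and "definable Q"
  shows "definable (\<lambda>s. P s \<and> Q s)"
proof -
  obtain p r where p: "\<And>s. P s \<longleftrightarrow> sat mem (interleave s r) p"
    using assms(1) unfolding definable_def by blast
  obtain q r' where q: "\<And>s. Q s \<longleftrightarrow> sat mem (interleave s r') q"
    using assms(2) unfolding definable_def by blast
  \<comment> \<open>The two parameter sequences are merged by a further interleaving: parameter
    \<open>k\<close> of \<open>p\<close> moves to position \<open>4 * k + 1\<close>, that of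
    \<open>q\<close> to position \<open>4 * k + 3\<close>. Variables stay where they are.\<close>
  define f :: "nat \<Rightarrow> nat" where "f n = (if even n then n else 4 * (n div 2) + 1)" for n
  define g :: "nat \<Rightarrow> nat" where "g n = (if even n then n else 4 * (n div 2) + 3)" for n
  have 1: "inj f" "inj g"
    unfolding f_def g_def inj_def by (auto, presburger+)
  have odd3: "(4 * k + 3) div 2 = 2 * k + 1" "(4 * k + 1) div 2 = 2 * k" for k :: nat by presburger+
  have "(\<lambda>n. interleave s (interleave r r') (f n)) = interleave s r"
       "(\<lambda>n. interleave s (interleave r r') (g n)) = interleave s r'" for s
    by (auto simp: fun_eq_iff interleave_def f_def g_def odd3 elim!: oddE)
  then have "P s \<and> Q s \<longleftrightarrow> sat mem (interleave s (interleave r r')) (Conj (rename f p) (rename g q))" for s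
    by (simp add: p q sat_rename 1)
  then show ?thesis unfolding definable_def by blast
qed

text \<open>The bound variable is moved to a fresh parameter position.\<close>

lemma definable_all:
  assumes "definable (\<lambda>s. Q (\<lambda>n. s (Suc n)) (s 0))"
  shows "definable (\<lambda>s. \<forall>a. Q s a)"
proof -
  obtain p r where p: "\<And>s. Q (\<lambda>n. s (Suc n)) (s 0) \<longleftrightarrow> sat mem (interleave s r) p"
    using assms unfolding definable_def by blast
  define f :: "nat \<Rightarrow> nat" where
    "f n = (if n = 0 then 1 else if even n then n - 2 else n + 2)" for n
  have 1: "inj f"
    unfolding f_def inj_def by (auto elim!: evenE split: if_splits) presburger+
  \<comment> \<open>Old parameter \<open>k\<close> becomes parameter \<open>k + 1\<close>. The new
    entry 0 is a placeholder: it is position 1 of the interleaving, which the quantifier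
    overwrites.\<close>
  define r' where "r' = case_nat undefined r"
  have "(\<lambda>n. ((interleave s r')(1 := a)) (f n)) = interleave (case_nat a s) r" for s a
  proof
    fix n
    show "((interleave s r')(1 := a)) (f n) = interleave (case_nat a s) r n"
    proof (cases "even n")
      case True
      then obtain k where "n = 2 * k" by blast
      then show ?thesis
        by (cases k) (auto simp: interleave_def f_def)
    next
      case False
      then obtain k where "n = 2 * k + 1" using oddE by blast
      then show ?thesis
        by (auto simp: interleave_def f_def r'_def)
    qed
  qed
  then have "(\<forall>a. Q s a) \<longleftrightarrow> sat mem (interleave s r') (All 1 (rename f p))" for s
    using p[of "case_nat _ s"] by (simp add: sat_rename 1)
  then show ?thesis unfolding definable_def by blast
qed

lemma definable_disj:
  assumes "definable P" and "definable Q"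
  shows "definable (\<lambda>s. P s \<or> Q s)"
  using definable_not[OF definable_conj[OF definable_not[OF assms(1)] definable_not[OF assms(2)]]]
  by simp

lemma definable_imp:
  assumes "definable P" and "definable Q"
  shows "definable (\<lambda>s. P s \<longrightarrow> Q s)"
  using definable_not[OF definable_conj[OF assms(1) definable_not[OF assms(2)]]] by simp

lemma definable_iff:
  assumes "definable P" and "definable Q"
  shows "definable (\<lambda>s. P s \<longleftrightarrow> Q s)"
  using definable_conj[OF definable_imp[OF assms] definable_imp[OF assms(2,1)]]
  by (simp add: iff_conv_conj_imp)

lemma definable_ex:
  assumes "definable (\<lambda>s. Q (\<lambda>n. s (Suc n)) (s 0))"
  shows "definable (\<lambda>s. \<exists>a. Q s a)"
  using definable_not[OF definable_all[OF definable_not[OF assms]]] by simp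

lemma definable_const: "definable (\<lambda>s. b)"
proof (cases b)
  case True
  then show ?thesis using definable_eq_var[of 0 0] by simp
next
  case False
  then show ?thesis using definable_not[OF definable_eq_var[of 0 0]] by simp
qed

section \<open>Substitution of definable functions\<close>

text \<open>The language has no function terms, so a term is eliminated by quantifying over its
  value: \<exists>a with \<open>a = t s\<close> and \<open>Q s a\<close>.\<close>

lemma definable_subst:
  assumes "definable (\<lambda>s. Q (\<lambda>n. s (Suc n)) (s 0))" and "definable_fun t"
  shows "definable (\<lambda>s. Q s (t s))"
proof -
  have "definable (\<lambda>s. \<exists>a. a = t s \<and> Q s a)"
    using assms unfolding definable_fun_def by (intro definable_ex definable_conj)
  then show ?thesis by simp
qed

text \<open>Passing under a binder moves every free variable up by one index; this carries terms
  along.\<close>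

lemma definable_fun_shift:
  assumes "definable_fun t"
  shows "definable_fun (\<lambda>s. t (\<lambda>n. s (Suc n)))"
proof -
  have "inj (\<lambda>n. if n = 0 then 0 else Suc n)" by (auto simp: inj_def)
  from definable_reindex[OF assms[unfolded definable_fun_def] this]
  show ?thesis by (simp add: definable_fun_def)
qed

lemma definable_fun_var: "definable_fun (\<lambda>s. s i)"
  unfolding definable_fun_def by (rule definable_eq_var)

lemma definable_fun_const: "definable_fun (\<lambda>s. c)"
  unfolding definable_fun_def by (rule definable_eq_const)

lemma definable_mem:
  assumes "definable_fun t" and "definable_fun u"
  shows "definable (\<lambda>s. t s \<epsilon> u s)"
proof (rule definable_subst[OF _ assms(1)])
  show "definable (\<lambda>s. s 0 \<epsilon> u (\<lambda>n. s (Suc n)))"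
    by (rule definable_subst[OF _ definable_fun_shift[OF assms(2)]]) (rule definable_mem_var)
qed

lemma definable_eq:
  assumes "definable_fun t" and "definable_fun u"
  shows "definable (\<lambda>s. t s = u s)"
proof (rule definable_subst[OF _ assms(1)])
  show "definable (\<lambda>s. s 0 = u (\<lambda>n. s (Suc n)))"
    by (rule definable_subst[OF _ definable_fun_shift[OF assms(2)]]) (rule definable_eq_var)
qed

lemma definable_subset:
  assumes "definable_fun t" and "definable_fun u"
  shows "definable (\<lambda>s. t s \<sqsubseteq> u s)"
  unfolding subset_def
  by (intro definable_all definable_imp definable_mem definable_fun_var definable_fun_shift assms)

lemmas definable_intros =
  definable_const definable_not definable_conj definable_disj definable_imp definable_iff
  definable_all definable_ex definable_mem definable_eq definable_subset
  definable_fun_var definable_fun_const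

text \<open>Turns all variables except the first into parameters.\<close>

lemma definable_instance:
  assumes "definable (\<lambda>s. P (\<lambda>n. s (Suc n)) (s 0))"
  shows "definable (\<lambda>s'. P s (s' 0))"
proof -
  obtain p r where p: "\<And>s. P (\<lambda>n. s (Suc n)) (s 0) \<longleftrightarrow> sat mem (interleave s r) p"
    using assms unfolding definable_def by blast
  \<comment> \<open>Variable 0 stays a variable, variable \<open>k + 1\<close> becomes the parameter
    \<open>s k\<close> at position \<open>4 * k + 1\<close>, and the old parameter \<open>k\<close>
    moves to position \<open>4 * k + 3\<close>.\<close>
  define f :: "nat \<Rightarrow> nat" where
    "f n = (if n = 0 then 0 else if even n then 2 * n - 3 else 2 * n + 1)" for n
  have "inj f"
    unfolding f_def inj_def by (auto elim!: evenE oddE split: if_splits) presburger+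
  moreover have "(\<lambda>n. interleave s' (interleave s r) (f n)) = interleave (case_nat (s' 0) s) r" for s'
  proof
    fix n
    show "interleave s' (interleave s r) (f n) = interleave (case_nat (s' 0) s) r n"
    proof (cases "even n")
      case True
      then obtain k where "n = 2 * k" by blast
      then show ?thesis
        by (cases k) (auto simp: interleave_def f_def)
    next
      case False
      then obtain k where "n = 2 * k + 1" using oddE by blast
      then show ?thesis
        by (auto simp: interleave_def f_def)
    qed
  qed
  ultimately show ?thesis
    using p[of "case_nat _ s"]
    by (intro definable_renameI[of _ "interleave s r" f p]) auto
qed

section \<open>Separation and replacement for definable predicates\<close>

lemma separation_definable:
  assumes "definable (\<lambda>s. P (s 0))"
  shows "\<exists>C. \<forall>x. x \<epsilon> C \<longleftrightarrow> x \<epsilon> A \<and> P x"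
proof -
  obtain p r where p: "\<And>s. P (s 0) \<longleftrightarrow> sat mem (interleave s r) p"
    using assms unfolding definable_def by blast
  have "(interleave (\<lambda>_. A) r)(0 := x) = interleave ((\<lambda>_. A)(0 := x)) r" for x
    by (auto simp: interleave_def fun_eq_iff)
  then have "sat mem ((interleave (\<lambda>_. A) r)(0 := x)) p \<longleftrightarrow> P x" for x
    using p[of "(\<lambda>_. A)(0 := x)"] by simp
  then show ?thesis using separation[of A "interleave (\<lambda>_. A) r" p] by simp
qed

lemma replacement_definable:
  assumes "definable_fun (\<lambda>s. t (s 0))"
  shows "\<exists>C. \<forall>y. y \<epsilon> C \<longleftrightarrow> (\<exists>x. x \<epsilon> A \<and> y = t x)"
proof -
  have "definable (\<lambda>s. s 1 = t (s 0))"
    by (intro definable_eq definable_fun_var assms)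
  then obtain p r where p: "\<And>s. s 1 = t (s 0) \<longleftrightarrow> sat mem (interleave s r) p"
    unfolding definable_def by blast
  \<comment> \<open>The replacement axiom puts the value at position 1, but variable 1 sits at
    position 2 of an interleaved assignment. The involution \<open>f\<close> exchanges the
    two.\<close>
  define f :: "nat \<Rightarrow> nat" where "f n = (if n = 1 then 2 else if n = 2 then 1 else n)" for n
  have f: "inj f" by (auto simp: f_def inj_def)
  have "(\<lambda>n. ((\<lambda>n. interleave (\<lambda>_. A) r (f n))(0 := x, 1 := y)) (f n))
      = interleave ((\<lambda>_. A)(0 := x, 1 := y)) r" for x y
    by (auto simp: interleave_def fun_eq_iff f_def)
  then have "sat mem ((\<lambda>n. interleave (\<lambda>_. A) r (f n))(0 := x, 1 := y)) (rename f p) \<longleftrightarrow> y = t x" for x y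
    using p[of "(\<lambda>_. A)(0 := x, 1 := y)"] by (simp add: sat_rename f)
  then show ?thesis
    using replacement[of A "\<lambda>n. interleave (\<lambda>_. A) r (f n)" "rename f p"] by simp
qed


section \<open>Set constructions\<close>

lemma mem_the_set:
  assumes "\<exists>A. \<forall>x. x \<epsilon> A \<longleftrightarrow> P x"
  shows "x \<epsilon> (SET x. P x) \<longleftrightarrow> P x"
proof -
  obtain A where A: "\<forall>x. x \<epsilon> A \<longleftrightarrow> P x" using assms by blast
  then have "(SET x. P x) = A"
    unfolding the_set_def by (intro the_equality) (auto intro: extensionality)
  with A show ?thesis by simp
qed

text \<open>Once the set exists, extensionality makes the graph of the abstraction first-order:
  \<open>z\<close> is the value iff its members are exactly the \<open>x\<close> with
  \<open>P s x\<close>.\<close>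

lemma definable_fun_the_set:
  assumes "definable (\<lambda>s. P (\<lambda>n. s (Suc n)) (s 0))"
    and "\<And>s. \<exists>A. \<forall>x. x \<epsilon> A \<longleftrightarrow> P s x"
  shows "definable_fun (\<lambda>s. SET x. P s x)"
proof -
  have eq: "z = (SET x. P s x) \<longleftrightarrow> (\<forall>x. x \<epsilon> z \<longleftrightarrow> P s x)" for z s
    using mem_the_set[OF assms(2)[of s]] extensionality by blast
  \<comment> \<open>Under the quantifier over \<open>x\<close>, index 0 is \<open>x\<close> and
    index 1 is \<open>z\<close>; the reindexing makes the predicate skip index 1.\<close>
  have "inj (\<lambda>n. if n = 0 then 0 else Suc n)" by (auto simp: inj_def)
  from definable_reindex[OF assms(1) this]
  have "definable (\<lambda>s. P (\<lambda>n. s (Suc (Suc n))) (s 0))" by simp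
  then show ?thesis
    unfolding definable_fun_def eq by (intro definable_intros)
qed

lemma ext: "(\<And>x. x \<epsilon> A \<longleftrightarrow> x \<epsilon> B) \<Longrightarrow> A = B"
  using extensionality by blast

lemma subsetI: "(\<And>x. x \<epsilon> A \<Longrightarrow> x \<epsilon> B) \<Longrightarrow> A \<sqsubseteq> B"
  by (simp add: subset_def)

lemma subsetD: "A \<sqsubseteq> B \<Longrightarrow> x \<epsilon> A \<Longrightarrow> x \<epsilon> B"
  by (simp add: subset_def)

definition sep :: "'v \<Rightarrow> ('v \<Rightarrow> bool) \<Rightarrow> 'v" where
  "sep A P = (SET x. x \<epsilon> A \<and> P x)"

definition image :: "('v \<Rightarrow> 'v) \<Rightarrow> 'v \<Rightarrow> 'v" where
  "image t A = (SET y. \<exists>x. x \<epsilon> A \<and> y = t x)"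

lemma mem_sep: "definable (\<lambda>s. P (s 0)) \<Longrightarrow> x \<epsilon> sep A P \<longleftrightarrow> x \<epsilon> A \<and> P x"
  unfolding sep_def by (rule mem_the_set[OF separation_definable])

lemma sep_subset: "definable (\<lambda>s. P (s 0)) \<Longrightarrow> sep A P \<sqsubseteq> A"
  by (auto simp: subset_def mem_sep)

lemma mem_image: "definable_fun (\<lambda>s. t (s 0)) \<Longrightarrow> y \<epsilon> image t A \<longleftrightarrow> (\<exists>x. x \<epsilon> A \<and> y = t x)"
  unfolding image_def by (rule mem_the_set[OF replacement_definable])

text \<open>Existence of the set at a fixed assignment needs a predicate of one variable;
  \<open>definable_instance\<close> provides it by freezing the rest of the assignment as
  parameters.\<close>

lemma definable_fun_sep:
  assumes "definable_fun A" and "definable (\<lambda>s. P (\<lambda>n. s (Suc n)) (s 0))"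
  shows "definable_fun (\<lambda>s. sep (A s) (P s))"
  unfolding sep_def using assms
  by (intro definable_fun_the_set separation_definable definable_intros definable_fun_shift
      definable_instance[of P])

lemma separation_bounded:
  assumes "definable (\<lambda>s. P (s 0))" and "\<And>x. P x \<Longrightarrow> x \<epsilon> A"
  shows "\<exists>C. \<forall>x. x \<epsilon> C \<longleftrightarrow> P x"
  using separation_definable[OF assms(1), of A] assms(2) by metis

section \<open>The elementary set operations and their definability\<close>

lemma ex_union: "\<exists>C. \<forall>x. x \<epsilon> C \<longleftrightarrow> x \<epsilon> A \<or> x \<epsilon> B"
proof -
  obtain S where "\<forall>x. x \<epsilon> S \<longleftrightarrow> x = A \<or> x = B" using pairing by blast
  then show ?thesis using union_axiom[of S] by metis
qed

lemma ex_inter: "\<exists>C. \<forall>x. x \<epsilon> C \<longleftrightarrow> x \<epsilon> A \<and> x \<epsilon> B"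
  by (rule separation_definable) (intro definable_intros)

lemma ex_diff: "\<exists>C. \<forall>x. x \<epsilon> C \<longleftrightarrow> x \<epsilon> A \<and> \<not> x \<epsilon> B"
  by (rule separation_definable) (intro definable_intros)

lemma ex_powerset: "\<exists>C. \<forall>A. A \<epsilon> C \<longleftrightarrow> A \<sqsubseteq> X"
  unfolding subset_def by (rule powerset_axiom)

lemma not_mem_empty: "\<not> x \<epsilon> empty"
  unfolding empty_def
  \<comment> \<open>Here \<open>empty\<close> is merely some element of the universe to separate
    from; nothing about its members is presupposed.\<close>
  by (subst mem_the_set) (use separation_definable[OF definable_const, of empty False] in auto)

lemma mem_upair: "x \<epsilon> upair a b \<longleftrightarrow> x = a \<or> x = b"
  unfolding upair_def by (rule mem_the_set[OF pairing])

lemma mem_union: "x \<epsilon> union A B \<longleftrightarrow> x \<epsilon> A \<or> x \<epsilon> B"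
  unfolding union_def by (rule mem_the_set[OF ex_union])

lemma mem_inter: "x \<epsilon> inter A B \<longleftrightarrow> x \<epsilon> A \<and> x \<epsilon> B"
  unfolding inter_def by (rule mem_the_set[OF ex_inter])

lemma mem_diff: "x \<epsilon> diff A B \<longleftrightarrow> x \<epsilon> A \<and> \<not> x \<epsilon> B"
  unfolding diff_def by (rule mem_the_set[OF ex_diff])

lemma mem_bigunion: "x \<epsilon> bigunion S \<longleftrightarrow> (\<exists>A. A \<epsilon> S \<and> x \<epsilon> A)"
  unfolding bigunion_def by (rule mem_the_set[OF union_axiom])

lemma mem_powerset: "A \<epsilon> powerset X \<longleftrightarrow> A \<sqsubseteq> X"
  unfolding powerset_def by (rule mem_the_set[OF ex_powerset])

lemma mem_adjoin: "x \<epsilon> adjoin A a \<longleftrightarrow> x \<epsilon> A \<or> x = a"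
  unfolding adjoin_def by (simp add: mem_union mem_upair)

lemmas mem_simps [simp] = not_mem_empty mem_upair mem_union mem_inter mem_diff mem_bigunion
  mem_powerset mem_adjoin

lemma definable_fun_upair:
  "definable_fun t \<Longrightarrow> definable_fun u \<Longrightarrow> definable_fun (\<lambda>s. upair (t s) (u s))"
  unfolding upair_def
  by (intro definable_fun_the_set pairing definable_intros definable_fun_shift)

lemma definable_fun_pair:
  "definable_fun t \<Longrightarrow> definable_fun u \<Longrightarrow> definable_fun (\<lambda>s. pair (t s) (u s))"
  unfolding pair_def by (intro definable_fun_upair)

lemma definable_fun_union:
  "definable_fun t \<Longrightarrow> definable_fun u \<Longrightarrow> definable_fun (\<lambda>s. union (t s) (u s))"
  unfolding union_def
  by (intro definable_fun_the_set ex_union definable_intros definable_fun_shift)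

lemma definable_fun_adjoin:
  "definable_fun t \<Longrightarrow> definable_fun u \<Longrightarrow> definable_fun (\<lambda>s. adjoin (t s) (u s))"
  unfolding adjoin_def by (intro definable_fun_union definable_fun_upair)

lemma definable_fun_diff:
  "definable_fun t \<Longrightarrow> definable_fun u \<Longrightarrow> definable_fun (\<lambda>s. diff (t s) (u s))"
  unfolding diff_def
  by (intro definable_fun_the_set ex_diff definable_intros definable_fun_shift)

lemma definable_fun_bigunion:
  "definable_fun t \<Longrightarrow> definable_fun (\<lambda>s. bigunion (t s))"
  unfolding bigunion_def
  by (intro definable_fun_the_set union_axiom definable_intros definable_fun_shift)

lemma pair_eq_iff [simp]: "pair a b = pair c d \<longleftrightarrow> a = c \<and> b = d"
proof -
  have upair: "upair a b = upair c d \<longleftrightarrow> (a = c \<and> b = d) \<or> (a = d \<and> b = c)" for a b c d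
  proof
    assume "upair a b = upair c d"
    then have "x = a \<or> x = b \<longleftrightarrow> x = c \<or> x = d" for x by (metis mem_upair)
    then show "(a = c \<and> b = d) \<or> (a = d \<and> b = c)" by metis
  next
    assume "(a = c \<and> b = d) \<or> (a = d \<and> b = c)"
    then show "upair a b = upair c d" by (auto intro: ext)
  qed
  show ?thesis unfolding pair_def upair by auto
qed

lemma ex_product: "\<exists>C. \<forall>q. q \<epsilon> C \<longleftrightarrow> (\<exists>a b. a \<epsilon> A \<and> b \<epsilon> B \<and> q = pair a b)"
proof (rule separation_bounded)
  show "definable (\<lambda>s. \<exists>a b. a \<epsilon> A \<and> b \<epsilon> B \<and> s 0 = pair a b)"
    by (intro definable_intros definable_fun_pair)
  \<comment> \<open>A Kuratowski pair is a set of subsets of \<open>union A B\<close>, which gives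
    the bound that separation asks for.\<close>
  show "q \<epsilon> powerset (powerset (union A B))" if "\<exists>a b. a \<epsilon> A \<and> b \<epsilon> B \<and> q = pair a b" for q
    using that by (auto simp: pair_def subset_def)
qed

lemma mem_product: "q \<epsilon> product A B \<longleftrightarrow> (\<exists>a b. a \<epsilon> A \<and> b \<epsilon> B \<and> q = pair a b)"
  unfolding product_def by (rule mem_the_set[OF ex_product])

lemma pair_mem_product [simp]: "pair a b \<epsilon> product A B \<longleftrightarrow> a \<epsilon> A \<and> b \<epsilon> B"
  by (auto simp: mem_product)

lemma definable_fun_product:
  "definable_fun t \<Longrightarrow> definable_fun u \<Longrightarrow> definable_fun (\<lambda>s. product (t s) (u s))"
  unfolding product_def
  by (intro definable_fun_the_set ex_product definable_intros definable_fun_shift definable_fun_pair)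

lemma definable_ex1:
  assumes "definable (\<lambda>s. Q (\<lambda>n. s (Suc n)) (s 0))"
  shows "definable (\<lambda>s. \<exists>!a. Q s a)"
proof -
  \<comment> \<open>The uniqueness clause repeats the predicate under a second binder, so it is also
    required in a form that skips index 1.\<close>
  have "inj (\<lambda>n. if n = 0 then 0 else Suc n)" by (auto simp: inj_def)
  from definable_reindex[OF assms this]
  have "definable (\<lambda>s. Q (\<lambda>n. s (Suc (Suc n))) (s 0))" by simp
  then show ?thesis unfolding Ex1_def using assms by (intro definable_intros)
qed

lemmas definability = definable_intros definable_ex1 definable_fun_sep
  definable_fun_upair definable_fun_pair definable_fun_union definable_fun_adjoin
  definable_fun_diff definable_fun_bigunion definable_fun_product

lemma definable_bijection:
  assumes "definable_fun f" and "definable_fun A" and "definable_fun B"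
  shows "definable (\<lambda>s. bijection (f s) (A s) (B s))"
  unfolding bijection_def
  by (intro definability definable_fun_shift assms)

lemma definable_equipotent:
  assumes "definable_fun A" and "definable_fun B"
  shows "definable (\<lambda>s. equipotent (A s) (B s))"
  unfolding equipotent_def
  by (intro definability definable_bijection definable_fun_shift assms)

lemma definable_finite_set:
  assumes "definable_fun A"
  shows "definable (\<lambda>s. finite_set (A s))"
  unfolding finite_set_def
  by (intro definability definable_equipotent definable_fun_shift assms)

lemma ex_mem_if_not_empty: "A \<noteq> empty \<Longrightarrow> \<exists>x. x \<epsilon> A"
  by (metis ext not_mem_empty)

text \<open>The source of all bijections built from a rule: a definable relation that is total,
  single-valued and injective becomes a set by separation from the product, and matches
  \<open>A\<close> with its range.\<close>

lemma equipotent_range: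
  assumes R: "definable (\<lambda>s. R (s 0) (s 1))"
    and "\<And>x. x \<epsilon> A \<Longrightarrow> \<exists>y. y \<epsilon> B \<and> R x y"
    and "\<And>x y y'. \<lbrakk>x \<epsilon> A; y \<epsilon> B; y' \<epsilon> B; R x y; R x y'\<rbrakk> \<Longrightarrow> y = y'"
    and "\<And>x x' y. \<lbrakk>x \<epsilon> A; x' \<epsilon> A; y \<epsilon> B; R x y; R x' y\<rbrakk> \<Longrightarrow> x = x'"
  obtains C where "equipotent A C" and "C \<sqsubseteq> B"
    and "\<And>y. y \<epsilon> C \<Longrightarrow> \<exists>x. x \<epsilon> A \<and> R x y"
proof -
  have R1: "definable (\<lambda>s. R (s i) (s j))" if "i \<noteq> j" for i j
  proof -
    have 1: "definable (\<lambda>s. \<exists>x y. x = s i \<and> y = s j \<and> R x y)"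
    proof -
      \<comment> \<open>Of the two bound variables the inner one, \<open>y\<close>, has index 0 and
        \<open>x\<close> has index 1, so the arguments of \<open>R\<close> must be
        exchanged.\<close>
      have "inj (\<lambda>n::nat. if n = 0 then 1 else if n = 1 then 0 else n)" by (auto simp: inj_def)
      from definable_reindex[OF R this] have "definable (\<lambda>s. R (s 1) (s 0))" by simp
      then show ?thesis by (intro definability) simp
    qed
    then show ?thesis by simp
  qed
  have D: "definable (\<lambda>s. \<exists>x. x \<epsilon> A \<and> R x (s 0))"
    by (intro definability R1) simp
  define f where "f = sep (product A B) (\<lambda>q. \<exists>x y. q = pair x y \<and> R x y)"
  have f: "pair x y \<epsilon> f \<longleftrightarrow> x \<epsilon> A \<and> y \<epsilon> B \<and> R x y" for x y
    unfolding f_def by (subst mem_sep, (intro definability R1; simp), auto)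
  let ?C = "sep B (\<lambda>y. \<exists>x. x \<epsilon> A \<and> R x y)"
  have C: "y \<epsilon> ?C \<longleftrightarrow> y \<epsilon> B \<and> (\<exists>x. x \<epsilon> A \<and> R x y)" for y by (rule mem_sep[OF D])
  have "f \<sqsubseteq> product A B"
    unfolding f_def by (rule sep_subset) (intro definability R1; simp)
  have "f \<sqsubseteq> product A ?C"
  proof (rule subsetI)
    fix q assume q: "q \<epsilon> f"
    then have "q \<epsilon> product A B" using \<open>f \<sqsubseteq> product A B\<close> by (rule subsetD[rotated])
    then obtain x y where xy: "q = pair x y" unfolding mem_product by auto
    with q show "q \<epsilon> product A ?C" using f C by auto
  qed
  moreover have "\<exists>!b. pair a b \<epsilon> f" if a: "a \<epsilon> A" for a
  proof -
    obtain b where "b \<epsilon> B" "R a b" using assms(2) a by auto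
    then show ?thesis using f a assms(3) by (intro ex1I[of _ b]) auto
  qed
  moreover have "\<exists>!a. pair a b \<epsilon> f" if b: "b \<epsilon> ?C" for b
  proof -
    obtain a where "b \<epsilon> B" "a \<epsilon> A" "R a b" using b C by auto
    then show ?thesis using f assms(4) by (intro ex1I[of _ a]) auto
  qed
  ultimately have "bijection f A ?C"
    unfolding bijection_def by blast
  then have "equipotent A ?C"
    unfolding equipotent_def by blast
  then show ?thesis using that[of ?C] C sep_subset[OF D] by blast
qed

section \<open>Natural numbers, finite and countable sets\<close>

text \<open>The axiom of infinity speaks of zero and successors only through their members;
  extensionality identifies them with \<open>empty\<close> and \<open>adjoin x x\<close>. The
  resulting inductive set bounds \<open>omega\<close>, which therefore exists.\<close>

lemma mem_omega: "n \<epsilon> omega \<longleftrightarrow> (\<forall>I. empty \<epsilon> I \<and> (\<forall>x. x \<epsilon> I \<longrightarrow> adjoin x x \<epsilon> I) \<longrightarrow> n \<epsilon> I)"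
proof -
  obtain I e where e: "e \<epsilon> I" "\<forall>x. \<not> x \<epsilon> e"
    and I: "\<And>x. x \<epsilon> I \<Longrightarrow> \<exists>y. y \<epsilon> I \<and> (\<forall>z. z \<epsilon> y \<longleftrightarrow> z \<epsilon> x \<or> z = x)"
    using infinity by blast
  have "e = empty" using e(2) by (intro ext) simp
  moreover have "adjoin x x \<epsilon> I" if x: "x \<epsilon> I" for x
  proof -
    obtain y where "y \<epsilon> I" "\<forall>z. z \<epsilon> y \<longleftrightarrow> z \<epsilon> x \<or> z = x" using I x by blast
    moreover from this have "y = adjoin x x" by (intro ext) simp
    ultimately show ?thesis by simp
  qed
  ultimately show ?thesis unfolding omega_def using e(1)
    by (intro mem_the_set separation_bounded[of _ I]) (intro definability, blast)
qed

lemma zero_mem_omega [simp]: "empty \<epsilon> omega"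
  by (simp add: mem_omega)

lemma succ_mem_omega: "n \<epsilon> omega \<Longrightarrow> adjoin n n \<epsilon> omega"
  by (simp add: mem_omega)

text \<open>The numbers satisfying a definable \<open>P\<close> form an inductive set, and a number
  belongs to every inductive set. Definability is essential, since \<open>P\<close> must cut out an
  element of the universe.\<close>

lemma omega_induct:
  assumes "n \<epsilon> omega" and P: "definable (\<lambda>s. P (s 0))" and "P empty"
    and "\<And>n. n \<epsilon> omega \<Longrightarrow> P n \<Longrightarrow> P (adjoin n n)"
  shows "P n"
proof -
  have "n \<epsilon> sep omega P"
    using assms(1) by (rule mem_omega[THEN iffD1, rule_format])
      (use assms(3,4) in \<open>auto simp: mem_sep[OF P] succ_mem_omega\<close>)
  then show ?thesis by (simp add: mem_sep[OF P])
qed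

lemma mem_irrefl: "\<not> x \<epsilon> x"
  using foundation[of x "upair x x"] by auto

lemma omega_transitive:
  assumes "n \<epsilon> omega" and "m \<epsilon> n"
  shows "m \<epsilon> omega"
proof -
  have "n \<sqsubseteq> omega"
    by (rule omega_induct[OF assms(1)]) (intro definability, auto simp: subset_def)
  then show ?thesis using assms(2) by (rule subsetD)
qed

lemma nat_transitive:
  assumes "n \<epsilon> omega" and "m \<epsilon> n" and "k \<epsilon> m"
  shows "k \<epsilon> n"
proof -
  have "\<forall>m. m \<epsilon> n \<longrightarrow> m \<sqsubseteq> n"
    by (rule omega_induct[OF assms(1)]) (intro definability, auto simp: subset_def)
  then show ?thesis using assms(2,3) by (auto dest: subsetD)
qed

text \<open>Induction on \<open>m\<close>: the base uses that \<open>empty\<close> belongs to every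
  other number, the step that the successor of a member of \<open>n\<close> does not go beyond
  \<open>n\<close>.\<close>

lemma nat_linear:
  assumes "m \<epsilon> omega" and "n \<epsilon> omega"
  shows "m \<epsilon> n \<or> m = n \<or> n \<epsilon> m"
proof -
  have zero: "n = empty \<or> empty \<epsilon> n" if "n \<epsilon> omega" for n
    by (rule omega_induct[OF that]) (intro definability, auto)
  have succ: "\<forall>m. m \<epsilon> n \<longrightarrow> adjoin m m = n \<or> adjoin m m \<epsilon> n" if "n \<epsilon> omega" for n
    by (rule omega_induct[OF that]) (intro definability, auto)
  have "\<forall>n. n \<epsilon> omega \<longrightarrow> m \<epsilon> n \<or> m = n \<or> n \<epsilon> m"
    by (rule omega_induct[OF assms(1)]) (intro definability, use zero succ in auto)
  then show ?thesis using assms(2) by simp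
qed

text \<open>An \<epsilon>-minimal element supplied by foundation is a least one, because the members
  of a number are numbers. Least indices will stand in for choice.\<close>

lemma omega_least:
  assumes P: "definable (\<lambda>s. P (s 0))" and "n \<epsilon> omega" and "P n"
  obtains m where "m \<epsilon> omega" and "P m" and "\<And>k. k \<epsilon> m \<Longrightarrow> \<not> P k"
proof -
  have "n \<epsilon> sep omega P" using assms by (simp add: mem_sep)
  from foundation[OF this] obtain m where "m \<epsilon> sep omega P" "\<And>k. k \<epsilon> m \<Longrightarrow> \<not> k \<epsilon> sep omega P"
    by blast
  then show ?thesis using that omega_transitive by (simp add: mem_sep[OF P]) blast
qed

section \<open>Finite sets\<close>

lemma finite_set_empty: "finite_set empty"
  unfolding finite_set_def equipotent_def bijection_def
  by (rule exI[of _ empty], simp, rule exI[of _ empty]) (simp add: subset_def)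

text \<open>A new element is sent to \<open>n\<close> itself, the one member of
  \<open>adjoin n n\<close> that is not in \<open>n\<close> by \<open>mem_irrefl\<close>.\<close>

lemma finite_set_adjoin:
  assumes "finite_set A"
  shows "finite_set (adjoin A a)"
proof (cases "a \<epsilon> A")
  case True
  then have "adjoin A a = A" by (intro ext) auto
  then show ?thesis using assms by simp
next
  case False
  obtain n f where n: "n \<epsilon> omega" and f: "bijection f A n"
    using assms unfolding finite_set_def equipotent_def by blast
  have sub: "x \<epsilon> A \<and> y \<epsilon> n" if "pair x y \<epsilon> f" for x y
    using f that unfolding bijection_def by (auto dest: subsetD)
  have A: "\<exists>!y. pair x y \<epsilon> f" if "x \<epsilon> A" for x using f that unfolding bijection_def by blast
  have B: "\<exists>!x. pair x y \<epsilon> f" if "y \<epsilon> n" for y using f that unfolding bijection_def by blast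
  have "f \<sqsubseteq> product A n" using f unfolding bijection_def by blast
  then have "adjoin f (pair a n) \<sqsubseteq> product (adjoin A a) (adjoin n n)"
    by (auto simp: subset_def mem_product)
  moreover have "\<exists>!y. pair x y \<epsilon> adjoin f (pair a n)" if "x \<epsilon> adjoin A a" for x
  proof (cases "x = a")
    case True
    then show ?thesis using False sub by (auto intro!: ex1I[of _ n])
  next
    case x: False
    then show ?thesis using that A[of x] by simp
  qed
  moreover have "\<exists>!x. pair x y \<epsilon> adjoin f (pair a n)" if "y \<epsilon> adjoin n n" for y
  proof (cases "y = n")
    case True
    then show ?thesis using sub mem_irrefl by (auto intro!: ex1I[of _ a])
  next
    case y: False
    then show ?thesis using that B[of y] by simp
  qed
  ultimately have "bijection (adjoin f (pair a n)) (adjoin A a) (adjoin n n)"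
    unfolding bijection_def by blast
  then show ?thesis
    using succ_mem_omega[OF n] unfolding finite_set_def equipotent_def by blast
qed

text \<open>Any \<open>f\<close> that relates each element of \<open>A\<close> to some number below
  \<open>n\<close>, with no number shared by two elements, suffices. The induction on
  \<open>n\<close> treats all \<open>A\<close> simultaneously while \<open>f\<close> stays
  fixed.\<close>

lemma finite_set_if_injection:
  assumes "n \<epsilon> omega" and "\<And>x. x \<epsilon> A \<Longrightarrow> \<exists>m. m \<epsilon> n \<and> pair x m \<epsilon> f"
    and "\<And>x y m. x \<epsilon> A \<Longrightarrow> y \<epsilon> A \<Longrightarrow> pair x m \<epsilon> f \<Longrightarrow> pair y m \<epsilon> f \<Longrightarrow> x = y"
  shows "finite_set A"
proof -
  have "\<forall>A. (\<forall>x. x \<epsilon> A \<longrightarrow> (\<exists>m. m \<epsilon> n \<and> pair x m \<epsilon> f))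
      \<and> (\<forall>x y m. x \<epsilon> A \<and> y \<epsilon> A \<and> pair x m \<epsilon> f \<and> pair y m \<epsilon> f \<longrightarrow> x = y) \<longrightarrow> finite_set A"
    (is "\<forall>A. ?P A n \<and> ?I A \<longrightarrow> _")
  proof (rule omega_induct[OF assms(1)])
    show "definable (\<lambda>s. \<forall>A. ?P A (s 0) \<and> ?I A \<longrightarrow> finite_set A)"
      by (intro definability definable_finite_set)
    show "\<forall>A. ?P A empty \<and> ?I A \<longrightarrow> finite_set A"
      using finite_set_empty ex_mem_if_not_empty by (metis not_mem_empty)
  next
    fix n assume IH: "\<forall>A. ?P A n \<and> ?I A \<longrightarrow> finite_set A"
    show "\<forall>A. ?P A (adjoin n n) \<and> ?I A \<longrightarrow> finite_set A"
    proof (intro allI impI, elim conjE)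
      fix A assume A: "?P A (adjoin n n)" and inj: "?I A"
      \<comment> \<open>The elements that can be placed below \<open>n\<close>. Every other element
        is related to \<open>n\<close>, so by injectivity there is at most one.\<close>
      define A' where "A' = sep A (\<lambda>x. \<exists>m. m \<epsilon> n \<and> pair x m \<epsilon> f)"
      have A': "x \<epsilon> A' \<longleftrightarrow> x \<epsilon> A \<and> (\<exists>m. m \<epsilon> n \<and> pair x m \<epsilon> f)" for x
        unfolding A'_def by (intro mem_sep definability)
      have fin: "finite_set A'" using IH A' inj by blast
      show "finite_set A"
      proof (cases "A' = A")
        case False
        then obtain a where a: "a \<epsilon> A" "\<not> a \<epsilon> A'" using A' by (metis ext)
        then have "pair a n \<epsilon> f" using A A' by auto
        have "A = adjoin A' a"
        proof (rule ext)
          fix x show "x \<epsilon> A \<longleftrightarrow> x \<epsilon> adjoin A' a"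
            using A inj A' a \<open>pair a n \<epsilon> f\<close> by (metis mem_adjoin)
        qed
        then show ?thesis using finite_set_adjoin[OF fin] by simp
      qed (use fin in simp)
    qed
  qed
  then show ?thesis using assms(2,3) by blast
qed

lemma finite_set_subset:
  assumes "finite_set B" and "A \<sqsubseteq> B"
  shows "finite_set A"
proof -
  obtain n f where n: "n \<epsilon> omega" and f: "bijection f B n"
    using assms unfolding finite_set_def equipotent_def by blast
  have sub: "x \<epsilon> B \<and> m \<epsilon> n" if "pair x m \<epsilon> f" for x m
    using f that unfolding bijection_def by (auto dest: subsetD)
  show ?thesis
  proof (rule finite_set_if_injection[OF n])
    show "\<exists>m. m \<epsilon> n \<and> pair x m \<epsilon> f" if "x \<epsilon> A" for x
      using f subsetD[OF assms(2) that] sub unfolding bijection_def by blast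
    show "x = y" if "pair x m \<epsilon> f" "pair y m \<epsilon> f" for x y m
      using f that sub unfolding bijection_def by blast
  qed
qed

text \<open>Induction on the number of elements, for all sets of that size at once; the step removes
  the element \<open>a\<close> that is matched with \<open>n\<close>.\<close>

lemma finite_set_induct:
  assumes "finite_set A" and P: "definable (\<lambda>s. P (s 0))" and "P empty"
    and "\<And>A a. finite_set A \<Longrightarrow> P A \<Longrightarrow> P (adjoin A a)"
  shows "P A"
proof -
  obtain n where n: "n \<epsilon> omega" and A: "equipotent A n"
    using assms(1) unfolding finite_set_def by blast
  \<comment> \<open>The hypothesis has \<open>P\<close> at index 0 only; substituting a variable
    moves it under further binders.\<close>
  have Pi: "definable (\<lambda>s. P (s i))" for i
    by (rule definable_subst[where Q="\<lambda>_. P"]) (intro P definability)+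
  have "\<forall>A. equipotent A n \<longrightarrow> P A"
  proof (rule omega_induct[OF n])
    show "definable (\<lambda>s. \<forall>A. equipotent A (s 0) \<longrightarrow> P A)"
      by (intro definability definable_equipotent Pi)
    show "\<forall>A. equipotent A empty \<longrightarrow> P A"
    proof (intro allI impI)
      fix A assume "equipotent A empty"
      then have "A = empty"
        unfolding equipotent_def bijection_def subset_def mem_product
        by (intro ext) (metis not_mem_empty)
      then show "P A" using assms(3) by simp
    qed
  next
    fix n assume n: "n \<epsilon> omega" and IH: "\<forall>A. equipotent A n \<longrightarrow> P A"
    show "\<forall>A. equipotent A (adjoin n n) \<longrightarrow> P A"
    proof (intro allI impI)
      fix A assume "equipotent A (adjoin n n)"
      then obtain f where f: "bijection f A (adjoin n n)" unfolding equipotent_def by blast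
      have sub: "x \<epsilon> A \<and> y \<epsilon> adjoin n n" if "pair x y \<epsilon> f" for x y
        using f that unfolding bijection_def by (auto dest: subsetD)
      have A: "\<exists>!y. pair x y \<epsilon> f" if "x \<epsilon> A" for x using f that unfolding bijection_def by blast
      have B: "\<exists>!x. pair x y \<epsilon> f" if "y \<epsilon> adjoin n n" for y
        using f that unfolding bijection_def by blast
      obtain a where a: "pair a n \<epsilon> f" using B[of n] by auto
      \<comment> \<open>Since \<open>a\<close> and \<open>n\<close> are matched only with each
        other, deleting their pair leaves a bijection from \<open>A'\<close> to
        \<open>n\<close>.\<close>
      have a': "x = a \<longleftrightarrow> y = n" if "pair x y \<epsilon> f" for x y
        using A[of x] B[of n] that a sub by auto
      define A' where "A' = diff A (upair a a)"
      have "diff f (upair (pair a n) (pair a n)) \<sqsubseteq> product A' n"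
      proof (rule subsetI)
        fix q assume q: "q \<epsilon> diff f (upair (pair a n) (pair a n))"
        then have "q \<epsilon> product A (adjoin n n)" using f unfolding bijection_def by (auto dest: subsetD)
        with q show "q \<epsilon> product A' n" using a' by (auto simp: mem_product A'_def)
      qed
      moreover have "\<exists>!y. pair x y \<epsilon> diff f (upair (pair a n) (pair a n))" if "x \<epsilon> A'" for x
        using A[of x] that by (simp add: A'_def)
      moreover have "\<exists>!x. pair x y \<epsilon> diff f (upair (pair a n) (pair a n))" if "y \<epsilon> n" for y
      proof -
        have "y \<noteq> n" using that mem_irrefl by blast
        then show ?thesis using B[of y] that by simp
      qed
      ultimately have "equipotent A' n" unfolding equipotent_def bijection_def by blast
      then have "finite_set A'" "P A'" using n IH unfolding finite_set_def by blast+
      then have "P (adjoin A' a)" by (rule assms(4))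
      also have "adjoin A' a = A" using sub[OF a] by (intro ext) (auto simp: A'_def)
      finally show "P A" .
    qed
  qed
  then show ?thesis using A by blast
qed

lemma finite_set_union:
  assumes "finite_set A" and "finite_set B"
  shows "finite_set (union A B)"
proof (rule finite_set_induct[OF assms(2)])
  show "definable (\<lambda>s. finite_set (union A (s 0)))"
    by (intro definable_finite_set definability)
  have "union A empty = A" by (intro ext) simp
  then show "finite_set (union A empty)" using assms(1) by simp
  show "finite_set (union A (adjoin B b))" if "finite_set (union A B)" for B b
  proof -
    have "union A (adjoin B b) = adjoin (union A B) b" by (intro ext) auto
    then show ?thesis using finite_set_adjoin[OF that] by simp
  qed
qed

lemma finite_set_bigunion:
  assumes "finite_set S" and "\<And>A. A \<epsilon> S \<Longrightarrow> finite_set A"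
  shows "finite_set (bigunion S)"
proof -
  have "(\<forall>A. A \<epsilon> S \<longrightarrow> finite_set A) \<longrightarrow> finite_set (bigunion S)"
  proof (rule finite_set_induct[OF assms(1)])
    show "definable (\<lambda>s. (\<forall>A. A \<epsilon> s 0 \<longrightarrow> finite_set A) \<longrightarrow> finite_set (bigunion (s 0)))"
      by (intro definability definable_finite_set)
    have "bigunion empty = empty" by (intro ext) simp
    then show "(\<forall>A. A \<epsilon> empty \<longrightarrow> finite_set A) \<longrightarrow> finite_set (bigunion empty)"
      using finite_set_empty by simp
    show "(\<forall>A. A \<epsilon> adjoin S B \<longrightarrow> finite_set A) \<longrightarrow> finite_set (bigunion (adjoin S B))"
      if "(\<forall>A. A \<epsilon> S \<longrightarrow> finite_set A) \<longrightarrow> finite_set (bigunion S)" for S B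
    proof -
      have "bigunion (adjoin S B) = union (bigunion S) B" by (intro ext) auto
      then show ?thesis using that finite_set_union by simp
    qed
  qed
  then show ?thesis using assms(2) by blast
qed

text \<open>One covering set per point is picked by induction along the finite set, which requires
  no choice principle.\<close>

lemma finite_subcover:
  assumes "finite_set F" and "F \<sqsubseteq> bigunion G"
  obtains H where "H \<sqsubseteq> G" and "finite_set H" and "F \<sqsubseteq> bigunion H"
proof -
  have "F \<sqsubseteq> bigunion G \<longrightarrow> (\<exists>H. H \<sqsubseteq> G \<and> finite_set H \<and> F \<sqsubseteq> bigunion H)"
  proof (rule finite_set_induct[OF assms(1)])
    show "definable (\<lambda>s. s 0 \<sqsubseteq> bigunion G \<longrightarrow> (\<exists>H. H \<sqsubseteq> G \<and> finite_set H \<and> s 0 \<sqsubseteq> bigunion H))"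
      by (intro definability definable_finite_set)
    show "empty \<sqsubseteq> bigunion G \<longrightarrow> (\<exists>H. H \<sqsubseteq> G \<and> finite_set H \<and> empty \<sqsubseteq> bigunion H)"
      using finite_set_empty by (auto simp: subset_def intro!: exI[of _ empty])
    show "adjoin F a \<sqsubseteq> bigunion G \<longrightarrow> (\<exists>H. H \<sqsubseteq> G \<and> finite_set H \<and> adjoin F a \<sqsubseteq> bigunion H)"
      if IH: "F \<sqsubseteq> bigunion G \<longrightarrow> (\<exists>H. H \<sqsubseteq> G \<and> finite_set H \<and> F \<sqsubseteq> bigunion H)" for F a
    proof
      assume "adjoin F a \<sqsubseteq> bigunion G"
      then obtain A where A: "A \<epsilon> G" "a \<epsilon> A" and "F \<sqsubseteq> bigunion G"
        by (auto simp: subset_def)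
      then obtain H where H: "H \<sqsubseteq> G" "finite_set H" "F \<sqsubseteq> bigunion H" using IH by blast
      have "adjoin H A \<sqsubseteq> G" "adjoin F a \<sqsubseteq> bigunion (adjoin H A)"
        using H A unfolding subset_def by auto
      then show "\<exists>H. H \<sqsubseteq> G \<and> finite_set H \<and> adjoin F a \<sqsubseteq> bigunion H"
        using finite_set_adjoin[OF H(2)] by blast
    qed
  qed
  then show ?thesis using assms(2) that by blast
qed

section \<open>Countable sets\<close>

lemma finite_set_countable: "finite_set A \<Longrightarrow> countable_set A"
  unfolding finite_set_def countable_set_def using omega_transitive by (auto simp: subset_def)

lemma countable_setE:
  assumes "countable_set A"
  obtains f where "\<And>x y. pair x y \<epsilon> f \<Longrightarrow> x \<epsilon> A \<and> y \<epsilon> omega"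
    and "\<And>x. x \<epsilon> A \<Longrightarrow> \<exists>y. pair x y \<epsilon> f"
    and "\<And>x y y'. pair x y \<epsilon> f \<Longrightarrow> pair x y' \<epsilon> f \<Longrightarrow> y = y'"
    and "\<And>x x' y. pair x y \<epsilon> f \<Longrightarrow> pair x' y \<epsilon> f \<Longrightarrow> x = x'"
proof -
  obtain f B where B: "B \<sqsubseteq> omega" and f: "bijection f A B"
    using assms unfolding countable_set_def equipotent_def by blast
  have sub: "x \<epsilon> A \<and> y \<epsilon> B" if "pair x y \<epsilon> f" for x y
    using f that unfolding bijection_def by (auto dest: subsetD)
  show ?thesis
  proof (rule that)
    show "x \<epsilon> A \<and> y \<epsilon> omega" if "pair x y \<epsilon> f" for x y
      using sub[OF that] subsetD[OF B] by blast
    show "\<exists>y. pair x y \<epsilon> f" if "x \<epsilon> A" for x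
      using f that unfolding bijection_def by blast
    show "y = y'" if "pair x y \<epsilon> f" "pair x y' \<epsilon> f" for x y y'
      using f sub[OF that(1)] that unfolding bijection_def by blast
    show "x = x'" if "pair x y \<epsilon> f" "pair x' y \<epsilon> f" for x x' y
      using f sub[OF that(1)] that unfolding bijection_def by blast
  qed
qed

text \<open>Without choice a preimage cannot be selected for each image point. Instead each image
  point is indexed by the least number belonging to one of its preimages.\<close>

lemma countable_set_image:
  assumes "countable_set A" and t: "definable_fun (\<lambda>s. t (s 0))"
  shows "countable_set (image t A)"
proof -
  obtain f where f: "\<And>x y. pair x y \<epsilon> f \<Longrightarrow> x \<epsilon> A \<and> y \<epsilon> omega"
    "\<And>x. x \<epsilon> A \<Longrightarrow> \<exists>y. pair x y \<epsilon> f" "\<And>x x' y. pair x y \<epsilon> f \<Longrightarrow> pair x' y \<epsilon> f \<Longrightarrow> x = x'"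
    using countable_setE[OF assms(1)] by metis
  define Q where "Q c n \<longleftrightarrow> (\<exists>a. pair a n \<epsilon> f \<and> c = t a)" for c n
  define R where "R c n \<longleftrightarrow> Q c n \<and> (\<forall>m. m \<epsilon> n \<longrightarrow> \<not> Q c m)" for c n
  have ti: "definable_fun (\<lambda>s. t (s i))" for i
    unfolding definable_fun_def
    \<comment> \<open>The substituted variable must be the argument of \<open>t\<close>, whereas the
      graph has the value at index 0; the reindexing exchanges indices 0 and 1.\<close>
    by (rule definable_subst[where Q="\<lambda>s a. s 0 = t a"])
      (use definable_reindex[OF t[unfolded definable_fun_def], of "\<lambda>n. if n = 0 then 1 else if n = 1 then 0 else n"]
        in \<open>auto simp: inj_def intro!: definability\<close>)
  have R: "definable (\<lambda>s. R (s 0) (s 1))"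
    unfolding R_def Q_def by (intro definability ti)
  have least_ex: "\<exists>n. n \<epsilon> omega \<and> R c n" if c: "c \<epsilon> image t A" for c
  proof -
    obtain a n where "pair a n \<epsilon> f" "Q c n"
      using c f(2) unfolding mem_image[OF t] Q_def by blast
    moreover have "definable (\<lambda>s. Q c (s 0))" unfolding Q_def by (intro definability ti)
    ultimately obtain m where "m \<epsilon> omega" "Q c m" "\<And>k. k \<epsilon> m \<Longrightarrow> \<not> Q c k"
      using f(1) omega_least[of "Q c" n] by blast
    then show ?thesis unfolding R_def by blast
  qed
  have unique: "n = n'" if "n \<epsilon> omega" "n' \<epsilon> omega" "R c n" "R c n'" for c n n'
    using that nat_linear unfolding R_def by blast
  have inj: "c = c'" if "R c n" "R c' n" for c c' n
    using that f(3) unfolding R_def Q_def by blast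
  obtain C where "equipotent (image t A) C" "C \<sqsubseteq> omega"
    by (rule equipotent_range[OF R, of "image t A" omega]) (use least_ex unique inj in blast)+
  then show ?thesis unfolding countable_set_def by blast
qed

text \<open>The order of \<open>omega\<close> is pulled back along the injection \<open>f\<close>.
  This makes first countability a special case of having well-orderable neighborhood bases.\<close>

lemma countable_set_well_orderable:
  assumes "countable_set A"
  shows "well_orderable A"
proof -
  obtain f where f: "\<And>x y. pair x y \<epsilon> f \<Longrightarrow> x \<epsilon> A \<and> y \<epsilon> omega"
    "\<And>x. x \<epsilon> A \<Longrightarrow> \<exists>y. pair x y \<epsilon> f"
    "\<And>x y y'. pair x y \<epsilon> f \<Longrightarrow> pair x y' \<epsilon> f \<Longrightarrow> y = y'"
    "\<And>x x' y. pair x y \<epsilon> f \<Longrightarrow> pair x' y \<epsilon> f \<Longrightarrow> x = x'"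
    using countable_setE[OF assms] by metis
  define R where "R = sep (product A A)
    (\<lambda>q. \<exists>x y m n. q = pair x y \<and> pair x m \<epsilon> f \<and> pair y n \<epsilon> f \<and> m \<epsilon> n)"
  have D: "definable (\<lambda>s. \<exists>x y m n. s 0 = pair x y \<and> pair x m \<epsilon> f \<and> pair y n \<epsilon> f \<and> m \<epsilon> n)"
    by (intro definability)
  have R: "pair x y \<epsilon> R \<longleftrightarrow> (\<exists>m n. pair x m \<epsilon> f \<and> pair y n \<epsilon> f \<and> m \<epsilon> n)" for x y
    unfolding R_def mem_sep[OF D] using f(1) by auto
  have "R \<sqsubseteq> product A A" unfolding R_def by (rule sep_subset[OF D])
  moreover have "\<not> pair x x \<epsilon> R" for x
    unfolding R using f(3) mem_irrefl by blast
  moreover have "pair x z \<epsilon> R" if xyz: "pair x y \<epsilon> R" "pair y z \<epsilon> R" for x y z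
  proof -
    obtain k l l' m where "pair x k \<epsilon> f" "k \<epsilon> l" "pair y l \<epsilon> f" "pair y l' \<epsilon> f" "l' \<epsilon> m" "pair z m \<epsilon> f"
      using xyz unfolding R by blast
    moreover from this have "l = l'" using f(3) by blast
    ultimately show ?thesis unfolding R using f(1) nat_transitive by blast
  qed
  moreover have "x = y \<or> pair x y \<epsilon> R \<or> pair y x \<epsilon> R" if xy: "x \<epsilon> A" "y \<epsilon> A" for x y
  proof -
    obtain m n where "pair x m \<epsilon> f" "pair y n \<epsilon> f" using f(2) xy by blast
    then show ?thesis unfolding R using f nat_linear[of m n] by blast
  qed
  moreover have "\<exists>b. b \<epsilon> B \<and> (\<forall>x. x \<epsilon> B \<longrightarrow> \<not> pair x b \<epsilon> R)" if B: "B \<sqsubseteq> A" "B \<noteq> empty" for B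
  proof -
    obtain x where x: "x \<epsilon> B" using ex_mem_if_not_empty B(2) by blast
    moreover obtain n where "pair x n \<epsilon> f" using f(2) subsetD[OF B(1) x] by blast
    moreover have "definable (\<lambda>s. \<exists>x. x \<epsilon> B \<and> pair x (s 0) \<epsilon> f)" by (intro definability)
    \<comment> \<open>The least index occurring in \<open>B\<close> belongs to the minimal element
      of \<open>B\<close>.\<close>
    ultimately obtain k where "\<exists>x. x \<epsilon> B \<and> pair x k \<epsilon> f"
      and k: "\<And>l. l \<epsilon> k \<Longrightarrow> \<not> (\<exists>x. x \<epsilon> B \<and> pair x l \<epsilon> f)"
      using f(1) omega_least[of "\<lambda>k. \<exists>x. x \<epsilon> B \<and> pair x k \<epsilon> f" n] by blast
    then obtain b where b: "b \<epsilon> B" "pair b k \<epsilon> f" by blast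
    have "\<not> pair x b \<epsilon> R" if x: "x \<epsilon> B" for x
    proof
      assume "pair x b \<epsilon> R"
      then obtain l k' where l: "pair x l \<epsilon> f" "pair b k' \<epsilon> f" "l \<epsilon> k'" unfolding R by blast
      then have "l \<epsilon> k" using f(3)[OF b(2) l(2)] by simp
      then show False using k x l(1) by blast
    qed
    then show ?thesis using b(1) by blast
  qed
  ultimately show ?thesis unfolding well_orderable_def well_orders_def by blast
qed

text \<open>On an infinite set indexed by a subset of \<open>omega\<close>, the map to the element with the next
  larger index is injective and misses the first element.\<close>

lemma Dedekind_infinite_if_countable_subset:
  assumes "S \<sqsubseteq> A" and "countable_set S" and "\<not> finite_set S"
  shows "Dedekind_infinite A"
proof -
  obtain f where f: "\<And>x y. pair x y \<epsilon> f \<Longrightarrow> x \<epsilon> S \<and> y \<epsilon> omega"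
    "\<And>x. x \<epsilon> S \<Longrightarrow> \<exists>y. pair x y \<epsilon> f"
    "\<And>x y y'. pair x y \<epsilon> f \<Longrightarrow> pair x y' \<epsilon> f \<Longrightarrow> y = y'"
    "\<And>x x' y. pair x y \<epsilon> f \<Longrightarrow> pair x' y \<epsilon> f \<Longrightarrow> x = x'"
    using countable_setE[OF assms(2)] by metis
  have unbounded: "\<exists>y m. pair y m \<epsilon> f \<and> k \<epsilon> m" if k: "k \<epsilon> omega" for k
  proof (rule ccontr)
    assume neg: "\<not> (\<exists>y m. pair y m \<epsilon> f \<and> k \<epsilon> m)"
    \<comment> \<open>If no index exceeded \<open>k\<close>, all indices would lie in
      \<open>adjoin k k\<close> and \<open>S\<close> would be finite.\<close>
    have "\<exists>m. m \<epsilon> adjoin k k \<and> pair x m \<epsilon> f" if x: "x \<epsilon> S" for x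
    proof -
      obtain m where "pair x m \<epsilon> f" using f(2) x by blast
      then show ?thesis using neg f(1) nat_linear[OF k, of m] by auto
    qed
    then have "finite_set S" using finite_set_if_injection[OF succ_mem_omega[OF k]] f(4) by blast
    then show False using assms(3) by simp
  qed
  define N where "N x y \<longleftrightarrow> (\<exists>k m. pair x k \<epsilon> f \<and> pair y m \<epsilon> f \<and> k \<epsilon> m
    \<and> (\<forall>z l. pair z l \<epsilon> f \<and> k \<epsilon> l \<longrightarrow> \<not> l \<epsilon> m))" for x y
  \<comment> \<open>\<open>N\<close> is the passage to the next index inside \<open>S\<close>; the
    identity outside \<open>S\<close> extends it to all of \<open>A\<close>.\<close>
  define R where "R x y \<longleftrightarrow> (\<not> x \<epsilon> S \<and> y = x) \<or> N x y" for x y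
  have N_mem: "x \<epsilon> S \<and> y \<epsilon> S" if "N x y" for x y
    using that f(1) unfolding N_def by blast
  have next_ex: "\<exists>y. N x y" if x: "x \<epsilon> S" for x
  proof -
    obtain k where k: "pair x k \<epsilon> f" using f(2) x by blast
    then obtain y n where "pair y n \<epsilon> f" "k \<epsilon> n" using unbounded f(1) by blast
    moreover have "definable (\<lambda>s. \<exists>y. pair y (s 0) \<epsilon> f \<and> k \<epsilon> s 0)" by (intro definability)
    ultimately obtain m where "\<exists>y. pair y m \<epsilon> f \<and> k \<epsilon> m"
      and "\<And>l. l \<epsilon> m \<Longrightarrow> \<not> (\<exists>y. pair y l \<epsilon> f \<and> k \<epsilon> l)"
      using f(1) omega_least[of "\<lambda>m. \<exists>y. pair y m \<epsilon> f \<and> k \<epsilon> m" n] by blast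
    then show ?thesis using k unfolding N_def by blast
  qed
  have next_unique: "y = y'" if N: "N x y" "N x y'" for x y y'
  proof -
    obtain k m k' m' where m: "pair x k \<epsilon> f" "pair y m \<epsilon> f" "k \<epsilon> m"
      "\<And>z l. pair z l \<epsilon> f \<Longrightarrow> k \<epsilon> l \<Longrightarrow> \<not> l \<epsilon> m"
      and m': "pair x k' \<epsilon> f" "pair y' m' \<epsilon> f" "k' \<epsilon> m'"
      "\<And>z l. pair z l \<epsilon> f \<Longrightarrow> k' \<epsilon> l \<Longrightarrow> \<not> l \<epsilon> m'"
      using N unfolding N_def by blast
    moreover have "k = k'" using f(3) m(1) m'(1) .
    ultimately have "m = m'" using nat_linear[of m m'] f(1) by blast
    then show ?thesis using f(4) m(2) m'(2) by blast
  qed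
  have next_inj: "x = x'" if N: "N x y" "N x' y" for x x' y
  proof -
    obtain k m k' m' where m: "pair x k \<epsilon> f" "pair y m \<epsilon> f" "k \<epsilon> m"
      "\<And>z l. pair z l \<epsilon> f \<Longrightarrow> k \<epsilon> l \<Longrightarrow> \<not> l \<epsilon> m"
      and m': "pair x' k' \<epsilon> f" "pair y m' \<epsilon> f" "k' \<epsilon> m'"
      "\<And>z l. pair z l \<epsilon> f \<Longrightarrow> k' \<epsilon> l \<Longrightarrow> \<not> l \<epsilon> m'"
      using N unfolding N_def by blast
    moreover have "m = m'" using f(3) m(2) m'(2) .
    ultimately have "k = k'" using nat_linear[of k k'] f(1) by blast
    then show ?thesis using f(4) m(1) m'(1) by blast
  qed
  have R: "definable (\<lambda>s. R (s 0) (s 1))" unfolding R_def N_def by (intro definability)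
  have ex: "\<exists>y. y \<epsilon> A \<and> R x y" if x: "x \<epsilon> A" for x
  proof (cases "x \<epsilon> S")
    case True
    then obtain y where "N x y" using next_ex by blast
    moreover from this have "y \<epsilon> A" using N_mem subsetD[OF assms(1)] by blast
    ultimately show ?thesis unfolding R_def by blast
  qed (use x R_def in blast)
  have unique: "y = y'" if "R x y" "R x y'" for x y y'
    using that N_mem next_unique unfolding R_def by blast
  have inj: "x = x'" if "R x y" "R x' y" for x x' y
    using that N_mem next_inj unfolding R_def by blast
  obtain B where "equipotent A B" "B \<sqsubseteq> A" and B: "\<And>y. y \<epsilon> B \<Longrightarrow> \<exists>x. x \<epsilon> A \<and> R x y"
    by (rule equipotent_range[OF R, of A A]) (use ex unique inj in blast)+
  moreover have "B \<noteq> A"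
  proof -
    \<comment> \<open>The missed element \<open>y\<close> is the one of least index
      \<open>m\<close>: a predecessor under \<open>N\<close> would have an index in
      \<open>m\<close>.\<close>
    obtain x n where "pair x n \<epsilon> f"
      using unbounded[OF zero_mem_omega] by blast
    moreover have "definable (\<lambda>s. \<exists>x. pair x (s 0) \<epsilon> f)" by (intro definability)
    ultimately obtain m where "\<exists>x. pair x m \<epsilon> f" and m: "\<And>k. k \<epsilon> m \<Longrightarrow> \<not> (\<exists>x. pair x k \<epsilon> f)"
      using f(1) omega_least[of "\<lambda>m. \<exists>x. pair x m \<epsilon> f" n] by blast
    then obtain y where y: "pair y m \<epsilon> f" by blast
    have "\<not> N x y" for x
      using m y f(3) unfolding N_def by metis
    moreover have "y \<epsilon> S" using y f(1) by blast
    ultimately have "\<not> R x y" for x unfolding R_def by blast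
    then have "\<not> y \<epsilon> B" using B by blast
    moreover have "y \<epsilon> A" using y f(1) subsetD[OF assms(1)] by blast
    ultimately show ?thesis by metis
  qed
  ultimately show ?thesis
    unfolding Dedekind_infinite_def by blast
qed

lemma mem_Fin: "F \<epsilon> Fin X \<longleftrightarrow> F \<sqsubseteq> X \<and> finite_set F"
  unfolding Fin_def
  by (intro mem_the_set separation_bounded[of _ "powerset X"] definability definable_finite_set) simp

text \<open>The form in which quasi Dedekind-finiteness is applied: an infinite countable subset
  would make \<open>Fin X\<close> Dedekind-infinite.\<close>

lemma quasi_Dedekind_finite_countable:
  assumes "quasi_Dedekind_finite X" and "S \<sqsubseteq> Fin X" and "countable_set S"
  shows "finite_set S"
  using assms Dedekind_infinite_if_countable_subset unfolding quasi_Dedekind_finite_def by blast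
section \<open>Topology\<close>

lemma topological_spaceD:
  assumes "topological_space X T"
  shows "\<And>U. U \<epsilon> T \<Longrightarrow> U \<sqsubseteq> X" and "empty \<epsilon> T" and "X \<epsilon> T"
    and "\<And>U V. U \<epsilon> T \<Longrightarrow> V \<epsilon> T \<Longrightarrow> inter U V \<epsilon> T"
    and "\<And>S. S \<sqsubseteq> T \<Longrightarrow> bigunion S \<epsilon> T"
  using assms unfolding topological_space_def by (auto dest: subsetD)

text \<open>The union of all open subsets of \<open>A\<close> is used, so no neighborhood has to be
  selected for each point.\<close>

lemma openI:
  assumes "topological_space X T"
    and "\<And>x. x \<epsilon> A \<Longrightarrow> \<exists>U. U \<epsilon> T \<and> x \<epsilon> U \<and> U \<sqsubseteq> A"
  shows "A \<epsilon> T"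
proof -
  have D: "definable (\<lambda>s. s 0 \<sqsubseteq> A)" by (intro definability)
  have "U \<epsilon> sep T (\<lambda>U. U \<sqsubseteq> A) \<longleftrightarrow> U \<epsilon> T \<and> U \<sqsubseteq> A" for U by (rule mem_sep[OF D])
  then have "A = bigunion (sep T (\<lambda>U. U \<sqsubseteq> A))"
    using assms(2) by (intro ext) (simp, blast dest: subsetD)
  also have "\<dots> \<epsilon> T"
    using topological_spaceD(5)[OF assms(1) sep_subset[OF D]] .
  finally show ?thesis .
qed

text \<open>The P-space property for indexed families. Definability of \<open>t\<close> is what
  turns the family into a set, whose countability is inherited from the index set.\<close>

lemma P_space_open_Inter:
  assumes P: "P_space X T" and "countable_set S" and t: "definable_fun (\<lambda>s. t (s 0))"
    and "\<And>W. W \<epsilon> S \<Longrightarrow> t W \<epsilon> T"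
  obtains G where "G \<epsilon> T" and "\<And>x. x \<epsilon> G \<longleftrightarrow> x \<epsilon> X \<and> (\<forall>W. W \<epsilon> S \<longrightarrow> x \<epsilon> t W)"
proof -
  define G where "G = (SET x. x \<epsilon> X \<and> (\<forall>U. U \<epsilon> image t S \<longrightarrow> x \<epsilon> U))"
  have "image t S \<sqsubseteq> T"
    using assms(4) by (auto simp: subset_def mem_image[OF t])
  then have "G_delta X T G"
    unfolding G_delta_def G_def using countable_set_image[OF assms(2) t] by blast
  then have "G \<epsilon> T" using P unfolding P_space_def by blast
  moreover have "x \<epsilon> G \<longleftrightarrow> x \<epsilon> X \<and> (\<forall>W. W \<epsilon> S \<longrightarrow> x \<epsilon> t W)" for x
    unfolding G_def
    by (subst mem_the_set[OF separation_definable]) (intro definability, auto simp: mem_image[OF t])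
  ultimately show ?thesis using that by blast
qed

section \<open>The product topology\<close>

text \<open>Besides giving the pointwise criterion, the equivalence bounds all unions of boxes by
  \<open>powerset (product X Y)\<close>, so that the collection defining the topology is a
  set.\<close>

lemma mem_product_topology:
  assumes X: "topological_space X TX" and Y: "topological_space Y TY"
  shows "W \<epsilon> product_topology TX TY \<longleftrightarrow> W \<sqsubseteq> product X Y \<and>
    (\<forall>x y. pair x y \<epsilon> W \<longrightarrow>
      (\<exists>U V. U \<epsilon> TX \<and> V \<epsilon> TY \<and> x \<epsilon> U \<and> y \<epsilon> V \<and> product U V \<sqsubseteq> W))"
    (is "_ \<longleftrightarrow> ?Q W")
proof -
  define P where "P W \<longleftrightarrow> (\<exists>S. W = bigunion S
    \<and> (\<forall>B. B \<epsilon> S \<longrightarrow> (\<exists>U V. U \<epsilon> TX \<and> V \<epsilon> TY \<and> B = product U V)))" for W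
  have rect: "product U V \<sqsubseteq> product X Y" if "U \<epsilon> TX" "V \<epsilon> TY" for U V
    using that topological_spaceD(1)[OF X] topological_spaceD(1)[OF Y]
    by (auto simp: subset_def mem_product)
  have PQ: "P W \<longleftrightarrow> ?Q W" for W
  proof
    assume "P W"
    then obtain S where W: "W = bigunion S"
      and S: "\<And>B. B \<epsilon> S \<Longrightarrow> \<exists>U V. U \<epsilon> TX \<and> V \<epsilon> TY \<and> B = product U V"
      unfolding P_def by blast
    have "W \<sqsubseteq> product X Y"
    proof (rule subsetI)
      fix q assume "q \<epsilon> W"
      then obtain B where "B \<epsilon> S" "q \<epsilon> B" using W by auto
      then show "q \<epsilon> product X Y" using S rect subsetD by metis
    qed
    moreover have "\<exists>U V. U \<epsilon> TX \<and> V \<epsilon> TY \<and> x \<epsilon> U \<and> y \<epsilon> V \<and> product U V \<sqsubseteq> W"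
      if xy: "pair x y \<epsilon> W" for x y
    proof -
      obtain B where B: "B \<epsilon> S" "pair x y \<epsilon> B" using xy W by auto
      moreover obtain U V where "U \<epsilon> TX" "V \<epsilon> TY" "B = product U V" using S B(1) by blast
      moreover have "B \<sqsubseteq> W" using B(1) W by (auto simp: subset_def)
      ultimately show ?thesis by auto
    qed
    ultimately show "?Q W" by blast
  next
    assume Q: "?Q W"
    \<comment> \<open>All open boxes inside \<open>W\<close> are taken at once, again avoiding a
      choice for each point.\<close>
    define S where "S = sep (powerset W) (\<lambda>B. \<exists>U V. U \<epsilon> TX \<and> V \<epsilon> TY \<and> B = product U V)"
    have S: "B \<epsilon> S \<longleftrightarrow> B \<sqsubseteq> W \<and> (\<exists>U V. U \<epsilon> TX \<and> V \<epsilon> TY \<and> B = product U V)" for B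
      unfolding S_def by (subst mem_sep) (intro definability, simp)
    have "W = bigunion S"
    proof (rule ext)
      fix q
      show "q \<epsilon> W \<longleftrightarrow> q \<epsilon> bigunion S"
      proof
        assume q: "q \<epsilon> W"
        then obtain x y where xy: "q = pair x y" using Q by (meson mem_product subsetD)
        then obtain U V where UV: "U \<epsilon> TX" "V \<epsilon> TY" "x \<epsilon> U" "y \<epsilon> V" "product U V \<sqsubseteq> W"
          using Q q by blast
        then have "product U V \<epsilon> S" using S by blast
        then show "q \<epsilon> bigunion S" using UV xy by auto
      qed (use S subsetD in auto)
    qed
    then show "P W" unfolding P_def using S by blast
  qed
  have "\<exists>A. \<forall>W. W \<epsilon> A \<longleftrightarrow> P W"
    unfolding PQ by (rule separation_bounded[of _ "powerset (product X Y)"])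
      (intro definability, simp)
  then have "W \<epsilon> product_topology TX TY \<longleftrightarrow> P W"
    unfolding product_topology_def P_def by (rule mem_the_set)
  then show ?thesis unfolding PQ .
qed

lemma topological_space_product:
  assumes X: "topological_space X TX" and Y: "topological_space Y TY"
  shows "topological_space (product X Y) (product_topology TX TY)"
proof -
  note mem = mem_product_topology[OF X Y]
  let ?T = "product_topology TX TY"
  have "?T \<sqsubseteq> powerset (product X Y)" using mem by (auto intro: subsetI)
  moreover have "empty \<epsilon> ?T" unfolding mem by (simp add: subset_def)
  moreover have "product X Y \<epsilon> ?T"
    unfolding mem using topological_spaceD(3)[OF X] topological_spaceD(3)[OF Y]
    by (auto simp: subset_def)
  moreover have "inter W W' \<epsilon> ?T" if W: "W \<epsilon> ?T" "W' \<epsilon> ?T" for W W'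
    unfolding mem
  proof (intro conjI allI impI)
    show "inter W W' \<sqsubseteq> product X Y" using W(1) unfolding mem by (simp add: subset_def)
    fix x y assume "pair x y \<epsilon> inter W W'"
    then have xy: "pair x y \<epsilon> W" "pair x y \<epsilon> W'" by simp_all
    then obtain U V where UV: "U \<epsilon> TX" "V \<epsilon> TY" "x \<epsilon> U" "y \<epsilon> V" "product U V \<sqsubseteq> W"
      using W(1) unfolding mem by blast
    obtain U' V' where UV': "U' \<epsilon> TX" "V' \<epsilon> TY" "x \<epsilon> U'" "y \<epsilon> V'" "product U' V' \<sqsubseteq> W'"
      using W(2) xy unfolding mem by blast
    have "product (inter U U') (inter V V') \<sqsubseteq> inter W W'"
      using UV(5) UV'(5) by (auto simp: subset_def mem_product)
    then show "\<exists>U V. U \<epsilon> TX \<and> V \<epsilon> TY \<and> x \<epsilon> U \<and> y \<epsilon> V \<and> product U V \<sqsubseteq> inter W W'"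
      using UV UV' topological_spaceD(4)[OF X, of U U'] topological_spaceD(4)[OF Y, of V V']
      by (intro exI[of _ "inter U U'"] exI[of _ "inter V V'"]) simp
  qed
  moreover have "bigunion S \<epsilon> ?T" if S: "S \<sqsubseteq> ?T" for S
    unfolding mem
  proof (intro conjI allI impI)
    show "bigunion S \<sqsubseteq> product X Y"
      using S unfolding subset_def[of _ ?T] mem by (auto simp: subset_def)
    fix x y assume "pair x y \<epsilon> bigunion S"
    then obtain W where W: "W \<epsilon> S" "pair x y \<epsilon> W" by auto
    moreover have "W \<epsilon> ?T" using subsetD[OF S W(1)] .
    ultimately obtain U V where "U \<epsilon> TX" "V \<epsilon> TY" "x \<epsilon> U" "y \<epsilon> V" "product U V \<sqsubseteq> W"
      unfolding mem by blast
    moreover have "W \<sqsubseteq> bigunion S" using W(1) by (auto simp: subset_def)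
    ultimately show "\<exists>U V. U \<epsilon> TX \<and> V \<epsilon> TY \<and> x \<epsilon> U \<and> y \<epsilon> V \<and> product U V \<sqsubseteq> bigunion S"
      unfolding subset_def by blast
  qed
  ultimately show ?thesis unfolding topological_space_def by blast
qed

text \<open>The reduction behind every case: a single open box around the point must fit into all
  members of the family. Boxes for different points are never combined by choice, since openness in
  the product is a pointwise condition.\<close>

lemma P_space_productI:
  assumes X: "topological_space X TX" and Y: "topological_space Y TY"
    and rect: "\<And>S x y. \<lbrakk>S \<sqsubseteq> product_topology TX TY; countable_set S; x \<epsilon> X; y \<epsilon> Y;
        \<And>W. W \<epsilon> S \<Longrightarrow> pair x y \<epsilon> W\<rbrakk> \<Longrightarrow>
      \<exists>U V. U \<epsilon> TX \<and> V \<epsilon> TY \<and> x \<epsilon> U \<and> y \<epsilon> V \<and> (\<forall>W. W \<epsilon> S \<longrightarrow> product U V \<sqsubseteq> W)"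
  shows "P_space (product X Y) (product_topology TX TY)"
  unfolding P_space_def
proof (intro conjI allI impI)
  show "topological_space (product X Y) (product_topology TX TY)"
    by (rule topological_space_product[OF X Y])
  fix G assume "G_delta (product X Y) (product_topology TX TY) G"
  then obtain S where S: "S \<sqsubseteq> product_topology TX TY" "countable_set S"
    and G: "G = (SET q. q \<epsilon> product X Y \<and> (\<forall>W. W \<epsilon> S \<longrightarrow> q \<epsilon> W))"
    unfolding G_delta_def by blast
  have mem_G: "q \<epsilon> G \<longleftrightarrow> q \<epsilon> product X Y \<and> (\<forall>W. W \<epsilon> S \<longrightarrow> q \<epsilon> W)" for q
    unfolding G by (rule mem_the_set[OF separation_definable]) (intro definability)
  show "G \<epsilon> product_topology TX TY"
    unfolding mem_product_topology[OF X Y]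
  proof (intro conjI allI impI)
    show "G \<sqsubseteq> product X Y" by (simp add: subset_def mem_G)
    fix x y assume "pair x y \<epsilon> G"
    then obtain U V where UV: "U \<epsilon> TX" "V \<epsilon> TY" "x \<epsilon> U" "y \<epsilon> V"
      "\<And>W. W \<epsilon> S \<Longrightarrow> product U V \<sqsubseteq> W"
      using rect[OF S, of x y] unfolding mem_G by auto
    moreover have "product U V \<sqsubseteq> G"
      using UV topological_spaceD(1)[OF X, of U] topological_spaceD(1)[OF Y, of V]
      by (auto simp: subset_def mem_G mem_product)
    ultimately show "\<exists>U V. U \<epsilon> TX \<and> V \<epsilon> TY \<and> x \<epsilon> U \<and> y \<epsilon> V \<and> product U V \<sqsubseteq> G" by blast
  qed
qed

text \<open>The largest open second side: being determined by \<open>B\<close> and \<open>W\<close>, it can be taken for all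
  members of a countable family without choice.\<close>

definition max_side :: "'v \<Rightarrow> 'v \<Rightarrow> 'v \<Rightarrow> 'v \<Rightarrow> 'v" where
  "max_side Y TY B W = sep Y (\<lambda>y. \<exists>V. V \<epsilon> TY \<and> y \<epsilon> V \<and> product B V \<sqsubseteq> W)"

lemma definable_fun_max_side:
  assumes "definable_fun B" and "definable_fun W"
  shows "definable_fun (\<lambda>s. max_side Y TY (B s) (W s))"
  unfolding max_side_def by (intro definability definable_fun_shift assms)

lemma mem_max_side:
  assumes "topological_space Y TY"
  shows "y \<epsilon> max_side Y TY B W \<longleftrightarrow> (\<exists>V. V \<epsilon> TY \<and> y \<epsilon> V \<and> product B V \<sqsubseteq> W)"
  unfolding max_side_def
  by (subst mem_sep) (intro definability, use topological_spaceD(1)[OF assms] in \<open>auto dest: subsetD\<close>)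

lemma max_side_open:
  assumes "topological_space Y TY"
  shows "max_side Y TY B W \<epsilon> TY"
  by (rule openI[OF assms]) (auto simp: mem_max_side[OF assms] subset_def)

lemma product_max_side_subset:
  assumes "topological_space Y TY"
  shows "product B (max_side Y TY B W) \<sqsubseteq> W"
  by (auto simp: subset_def mem_product mem_max_side[OF assms])

section \<open>Products with locally well-orderable and with base-hereditarily Lindelof
  factors\<close>

lemma P_space_product_well_orderable:
  assumes X: "P_space X TX" and Y: "P_space Y TY"
    and wo: "\<And>x. x \<epsilon> X \<Longrightarrow> \<exists>B. neighborhood_base X TX x B \<and> well_orderable B"
  shows "P_space (product X Y) (product_topology TX TY)"
proof -
  have TX: "topological_space X TX" and TY: "topological_space Y TY"
    using X Y unfolding P_space_def by blast+
  note mem_max = mem_max_side[OF TY]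
  show ?thesis
  proof (rule P_space_productI[OF TX TY])
    fix S x y
    assume S: "S \<sqsubseteq> product_topology TX TY" "countable_set S" and x: "x \<epsilon> X" and y: "y \<epsilon> Y"
      and xy: "\<And>W. W \<epsilon> S \<Longrightarrow> pair x y \<epsilon> W"
    obtain B R where B: "neighborhood_base X TX x B" and R: "well_orders R B"
      using wo[OF x] unfolding well_orderable_def by blast
    \<comment> \<open>\<open>N\<close> is the \<open>R\<close>-least member of \<open>B\<close> that
      is good for \<open>W\<close>. The well-order makes it unique, which is the only selection in
      this case.\<close>
    define L where "L N W \<longleftrightarrow> N \<epsilon> B \<and> y \<epsilon> max_side Y TY N W
      \<and> (\<forall>M. M \<epsilon> B \<and> y \<epsilon> max_side Y TY M W \<longrightarrow> \<not> pair M N \<epsilon> R)" for N W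
    have L_ex: "\<exists>N. L N W" if W: "W \<epsilon> S" for W
    proof -
      obtain U V where UV: "U \<epsilon> TX" "V \<epsilon> TY" "x \<epsilon> U" "y \<epsilon> V" "product U V \<sqsubseteq> W"
        using subsetD[OF S(1) W] xy[OF W] unfolding mem_product_topology[OF TX TY] by blast
      have "neighborhood X TX x U"
        unfolding neighborhood_def using UV topological_spaceD(1)[OF TX] by (auto simp: subset_def)
      then obtain N where N: "N \<epsilon> B" "N \<sqsubseteq> U" using B unfolding neighborhood_base_def by blast
      have "y \<epsilon> max_side Y TY N W"
        unfolding mem_max using UV N(2) by (intro exI[of _ V]) (auto simp: subset_def mem_product)
      have D: "definable (\<lambda>s. y \<epsilon> max_side Y TY (s 0) W)"
        by (intro definability definable_fun_max_side)
      define C where "C = sep B (\<lambda>N. y \<epsilon> max_side Y TY N W)"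
      have C: "N \<epsilon> C \<longleftrightarrow> N \<epsilon> B \<and> y \<epsilon> max_side Y TY N W" for N
        unfolding C_def by (rule mem_sep[OF D])
      have "C \<sqsubseteq> B" unfolding C_def by (rule sep_subset[OF D])
      moreover have "C \<noteq> empty" using C N(1) \<open>y \<epsilon> max_side Y TY N W\<close> by (metis not_mem_empty)
      ultimately obtain M where "M \<epsilon> C" "\<forall>N. N \<epsilon> C \<longrightarrow> \<not> pair N M \<epsilon> R"
        using R unfolding well_orders_def by blast
      then show ?thesis unfolding L_def C by blast
    qed
    have L_unique: "N = M" if "L N W" "L M W" for N M W
      using R that unfolding L_def well_orders_def by blast
    \<comment> \<open>\<open>u W\<close> is the interior of the selected neighborhood, which may
      fail to be open itself, and \<open>v W\<close> is its largest second side. Quantifying over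
      \<open>N\<close> keeps both definable in \<open>W\<close>.\<close>
    define u where "u W = sep X (\<lambda>z. \<exists>N U. L N W \<and> U \<epsilon> TX \<and> z \<epsilon> U \<and> U \<sqsubseteq> N)" for W
    define v where "v W = sep Y (\<lambda>z. \<exists>N. L N W \<and> z \<epsilon> max_side Y TY N W)" for W
    have mem_u: "z \<epsilon> u W \<longleftrightarrow> z \<epsilon> X \<and> (\<exists>N U. L N W \<and> U \<epsilon> TX \<and> z \<epsilon> U \<and> U \<sqsubseteq> N)" for z W
      unfolding u_def L_def by (intro mem_sep definability definable_fun_max_side)
    have mem_v: "z \<epsilon> v W \<longleftrightarrow> z \<epsilon> Y \<and> (\<exists>N. L N W \<and> z \<epsilon> max_side Y TY N W)" for z W
      unfolding v_def L_def by (intro mem_sep definability definable_fun_max_side)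
    have du: "definable_fun (\<lambda>s. u (s 0))" and dv: "definable_fun (\<lambda>s. v (s 0))"
      unfolding u_def v_def L_def by (intro definability definable_fun_max_side)+
    have u: "u W \<epsilon> TX" if W: "W \<epsilon> S" for W
      by (rule openI[OF TX])
        (use topological_spaceD(1)[OF TX] in \<open>fastforce simp: mem_u subset_def\<close>)
    have v: "v W \<epsilon> TY" if W: "W \<epsilon> S" for W
    proof -
      obtain N where "L N W" using L_ex[OF W] by blast
      then have "v W = max_side Y TY N W"
        using L_unique subsetD[OF topological_spaceD(1)[OF TY max_side_open[OF TY]]]
        by (intro ext) (unfold mem_v, blast)
      then show ?thesis using max_side_open[OF TY] by simp
    qed
    have uv: "product (u W) (v W) \<sqsubseteq> W" for W
    proof (rule subsetI)
      fix q assume "q \<epsilon> product (u W) (v W)"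
      then obtain a b where q: "q = pair a b" "a \<epsilon> u W" "b \<epsilon> v W" unfolding mem_product by blast
      then obtain N where N: "a \<epsilon> N" "b \<epsilon> max_side Y TY N W"
        unfolding mem_u mem_v using L_unique subsetD by metis
      then show "q \<epsilon> W"
        using subsetD[OF product_max_side_subset[OF TY]] q(1) by (metis pair_mem_product)
    qed
    have xu: "x \<epsilon> u W" and yv: "y \<epsilon> v W" if W: "W \<epsilon> S" for W
    proof -
      obtain N where N: "L N W" using L_ex[OF W] by blast
      then have "neighborhood X TX x N" using B unfolding L_def neighborhood_base_def by blast
      then show "x \<epsilon> u W" using N x unfolding mem_u neighborhood_def by blast
      show "y \<epsilon> v W" using N y unfolding mem_v L_def by blast
    qed
    \<comment> \<open>Each factor is a P-space, so the countably many first sides and the countably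
      many second sides have open intersections.\<close>
    obtain U where "U \<epsilon> TX" and U: "\<And>z. z \<epsilon> U \<longleftrightarrow> z \<epsilon> X \<and> (\<forall>W. W \<epsilon> S \<longrightarrow> z \<epsilon> u W)"
      using P_space_open_Inter[OF X S(2) du u] by blast
    obtain V where "V \<epsilon> TY" and V: "\<And>z. z \<epsilon> V \<longleftrightarrow> z \<epsilon> Y \<and> (\<forall>W. W \<epsilon> S \<longrightarrow> z \<epsilon> v W)"
      using P_space_open_Inter[OF Y S(2) dv v] by blast
    have "product U V \<sqsubseteq> W" if W: "W \<epsilon> S" for W
    proof (rule subsetI)
      fix q assume "q \<epsilon> product U V"
      then have "q \<epsilon> product (u W) (v W)" using W U V unfolding mem_product by blast
      then show "q \<epsilon> W" by (rule subsetD[OF uv])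
    qed
    moreover have "x \<epsilon> U" "y \<epsilon> V" using U V x y xu yv by blast+
    ultimately show "\<exists>U V. U \<epsilon> TX \<and> V \<epsilon> TY \<and> x \<epsilon> U \<and> y \<epsilon> V \<and> (\<forall>W. W \<epsilon> S \<longrightarrow> product U V \<sqsubseteq> W)"
      using \<open>U \<epsilon> TX\<close> \<open>V \<epsilon> TY\<close> by blast
  qed
qed

lemma P_space_product_base_hereditarily_Lindelof:
  assumes X: "P_space X TX" and Y: "P_space Y TY" and L: "base_hereditarily_Lindelof X TX"
  shows "P_space (product X Y) (product_topology TX TY)"
proof -
  have TX: "topological_space X TX" and TY: "topological_space Y TY"
    using X Y unfolding P_space_def by blast+
  note mem_max = mem_max_side[OF TY]
  obtain \<B> where base: "base TX \<B>"
    and Lindelof: "\<And>B \<G>. \<lbrakk>B \<epsilon> \<B>; \<G> \<sqsubseteq> \<B>; B \<sqsubseteq> bigunion \<G>\<rbrakk> \<Longrightarrow>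
      \<exists>\<H>. \<H> \<sqsubseteq> \<G> \<and> countable_set \<H> \<and> B \<sqsubseteq> bigunion \<H>"
    using L unfolding base_hereditarily_Lindelof_def by blast
  have \<B>_TX: "\<B> \<sqsubseteq> TX" using base unfolding base_def by blast
  have base_point: "\<exists>B. B \<epsilon> \<B> \<and> x \<epsilon> B \<and> B \<sqsubseteq> U" if U: "U \<epsilon> TX" "x \<epsilon> U" for U x
  proof -
    obtain S where "S \<sqsubseteq> \<B>" "U = bigunion S" using base U(1) unfolding base_def by blast
    then show ?thesis using U(2) by (auto simp: subset_def)
  qed
  show ?thesis
  proof (rule P_space_productI[OF TX TY])
    fix S x y
    assume S: "S \<sqsubseteq> product_topology TX TY" "countable_set S" and x: "x \<epsilon> X" and y: "y \<epsilon> Y"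
      and xy: "\<And>W. W \<epsilon> S \<Longrightarrow> pair x y \<epsilon> W"
    \<comment> \<open>The base sets that are good for \<open>W\<close>; they are all kept, so
      nothing is selected.\<close>
    define g where "g W = sep \<B> (\<lambda>B. y \<epsilon> max_side Y TY B W)" for W
    have mem_g: "B \<epsilon> g W \<longleftrightarrow> B \<epsilon> \<B> \<and> y \<epsilon> max_side Y TY B W" for B W
      unfolding g_def by (intro mem_sep definability definable_fun_max_side)
    have dg: "definable_fun (\<lambda>s. bigunion (g (s 0)))"
      unfolding g_def by (intro definability definable_fun_max_side)
    have g_open: "bigunion (g W) \<epsilon> TX" for W
      using mem_g subsetD[OF \<B>_TX] by (intro topological_spaceD(5)[OF TX] subsetI) blast
    have x_g: "x \<epsilon> bigunion (g W)" if W: "W \<epsilon> S" for W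
    proof -
      obtain U V where UV: "U \<epsilon> TX" "V \<epsilon> TY" "x \<epsilon> U" "y \<epsilon> V" "product U V \<sqsubseteq> W"
        using subsetD[OF S(1) W] xy[OF W] unfolding mem_product_topology[OF TX TY] by blast
      obtain B where B: "B \<epsilon> \<B>" "x \<epsilon> B" "B \<sqsubseteq> U" using base_point UV by blast
      then have "y \<epsilon> max_side Y TY B W"
        unfolding mem_max using UV by (intro exI[of _ V]) (auto simp: subset_def mem_product)
      then show ?thesis using B mem_g by auto
    qed
    obtain O' where "O' \<epsilon> TX" and O': "\<And>z. z \<epsilon> O' \<longleftrightarrow> z \<epsilon> X \<and> (\<forall>W. W \<epsilon> S \<longrightarrow> z \<epsilon> bigunion (g W))"
      using P_space_open_Inter[OF X S(2) dg g_open] by blast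
    moreover have "x \<epsilon> O'" using O' x x_g by blast
    ultimately obtain B where B: "B \<epsilon> \<B>" "x \<epsilon> B" "B \<sqsubseteq> O'" using base_point by blast
    \<comment> \<open>\<open>B\<close> is so far only covered by good sets. Countably many of them,
      \<open>H\<close>, still cover \<open>B\<close>, and the intersection \<open>V\<close> of their
      largest second sides is open and contains \<open>y\<close>; the box over \<open>B\<close> and
      \<open>V\<close> then fits into \<open>W\<close>.\<close>
    have y_max: "y \<epsilon> max_side Y TY B W" if W: "W \<epsilon> S" for W
    proof -
      have "B \<sqsubseteq> bigunion (g W)" using B(3) O' W by (auto simp: subset_def)
      moreover have "g W \<sqsubseteq> \<B>" using mem_g by (auto simp: subset_def)
      ultimately obtain H where H: "H \<sqsubseteq> g W" "countable_set H" "B \<sqsubseteq> bigunion H"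
        using Lindelof[OF B(1)] by blast
      have d: "definable_fun (\<lambda>s. max_side Y TY (s 0) W)"
        by (intro definability definable_fun_max_side)
      obtain V where "V \<epsilon> TY" and V: "\<And>z. z \<epsilon> V \<longleftrightarrow> z \<epsilon> Y \<and> (\<forall>A. A \<epsilon> H \<longrightarrow> z \<epsilon> max_side Y TY A W)"
        using P_space_open_Inter[OF Y H(2) d max_side_open[OF TY]] by blast
      have "y \<epsilon> V" using V y H(1) mem_g subsetD by metis
      moreover have "product B V \<sqsubseteq> W"
      proof (rule subsetI)
        fix q assume "q \<epsilon> product B V"
        then obtain a b where q: "q = pair a b" "a \<epsilon> B" "b \<epsilon> V" unfolding mem_product by blast
        then obtain A where A: "A \<epsilon> H" "a \<epsilon> A" using subsetD[OF H(3)] by auto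
        then have "q \<epsilon> product A (max_side Y TY A W)" using q V by simp
        then show "q \<epsilon> W" by (rule subsetD[OF product_max_side_subset[OF TY]])
      qed
      ultimately show ?thesis unfolding mem_max using \<open>V \<epsilon> TY\<close> by blast
    qed
    have d: "definable_fun (\<lambda>s. max_side Y TY B (s 0))"
      by (intro definability definable_fun_max_side)
    \<comment> \<open>A second use of the P-space property of \<open>Y\<close>, now over the
      countably many \<open>W\<close> with the first side \<open>B\<close> fixed.\<close>
    obtain V where "V \<epsilon> TY" and V: "\<And>z. z \<epsilon> V \<longleftrightarrow> z \<epsilon> Y \<and> (\<forall>W. W \<epsilon> S \<longrightarrow> z \<epsilon> max_side Y TY B W)"
      using P_space_open_Inter[OF Y S(2) d max_side_open[OF TY]] by blast
    have "product B V \<sqsubseteq> W" if W: "W \<epsilon> S" for W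
    proof (rule subsetI)
      fix q assume "q \<epsilon> product B V"
      then have "q \<epsilon> product B (max_side Y TY B W)" using W V unfolding mem_product by blast
      then show "q \<epsilon> W" by (rule subsetD[OF product_max_side_subset[OF TY]])
    qed
    moreover have "y \<epsilon> V" using V y y_max by blast
    ultimately show "\<exists>U V. U \<epsilon> TX \<and> V \<epsilon> TY \<and> x \<epsilon> U \<and> y \<epsilon> V \<and> (\<forall>W. W \<epsilon> S \<longrightarrow> product U V \<sqsubseteq> W)"
      using B(1,2) subsetD[OF \<B>_TX] \<open>V \<epsilon> TY\<close> by blast
  qed
qed

section \<open>Cofinite sets of quasi Dedekind-finite sets\<close>

lemma Fin_empty: "empty \<epsilon> Fin X"
  by (simp add: mem_Fin finite_set_empty subset_def)

lemma Fin_union: "F \<epsilon> Fin X \<Longrightarrow> G \<epsilon> Fin X \<Longrightarrow> union F G \<epsilon> Fin X"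
  by (auto simp: mem_Fin finite_set_union subset_def)

lemma Fin_subset: "F \<epsilon> Fin X \<Longrightarrow> G \<sqsubseteq> F \<Longrightarrow> G \<epsilon> Fin X"
  using finite_set_subset by (auto simp: mem_Fin subset_def)

lemma diff_diff_cancel: "F \<sqsubseteq> A \<Longrightarrow> diff A (diff A F) = F"
  by (intro ext) (auto simp: subset_def)

text \<open>The complements form a countable subset of \<open>Fin X\<close>, hence there are
  finitely many of them, and a finite union of finite sets is finite. \<open>Z\<close> will be
  \<open>X\<close> or \<open>adjoin X p\<close>.\<close>

lemma Fin_countable_union_of_complements:
  assumes "quasi_Dedekind_finite X" and "countable_set S"
    and "\<And>U. U \<epsilon> S \<Longrightarrow> diff Z U \<epsilon> Fin X"
  obtains F where "F \<epsilon> Fin X" and "\<And>x. x \<epsilon> F \<longleftrightarrow> x \<epsilon> Z \<and> (\<exists>U. U \<epsilon> S \<and> \<not> x \<epsilon> U)"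
proof -
  have d: "definable_fun (\<lambda>s. diff Z (s 0))" by (intro definability)
  let ?I = "image (diff Z) S"
  have I: "A \<epsilon> ?I \<longleftrightarrow> (\<exists>U. U \<epsilon> S \<and> A = diff Z U)" for A by (rule mem_image[OF d])
  have "?I \<sqsubseteq> Fin X" using assms(3) I by (auto simp: subset_def)
  then have "finite_set ?I"
    using quasi_Dedekind_finite_countable assms(1) countable_set_image[OF assms(2) d] by blast
  then have "finite_set (bigunion ?I)"
    by (rule finite_set_bigunion) (use assms(3) I mem_Fin in auto)
  moreover have "bigunion ?I \<sqsubseteq> X"
    using assms(3) I mem_Fin by (fastforce simp: subset_def)
  moreover have "x \<epsilon> bigunion ?I \<longleftrightarrow> x \<epsilon> Z \<and> (\<exists>U. U \<epsilon> S \<and> \<not> x \<epsilon> U)" for x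
    by (auto simp: I)
  ultimately show ?thesis using that[of "bigunion ?I"] mem_Fin by blast
qed

text \<open>The guard \<open>x \<epsilon> U\<close> expresses that \<open>U\<close> is nonempty. In
  this form unions and intersections need no separate treatment of the empty set.\<close>

lemma mem_cofinite_topology:
  "U \<epsilon> cofinite_topology X \<longleftrightarrow> U \<sqsubseteq> X \<and> (\<forall>x. x \<epsilon> U \<longrightarrow> diff X U \<epsilon> Fin X)"
proof -
  have "U \<epsilon> cofinite_topology X \<longleftrightarrow> U = empty \<or> (\<exists>F. F \<epsilon> Fin X \<and> U = diff X F)"
    unfolding cofinite_topology_def
    by (intro mem_the_set separation_bounded[of _ "powerset X"] definability)
      (auto simp: subset_def)
  also have "\<dots> \<longleftrightarrow> U \<sqsubseteq> X \<and> (\<forall>x. x \<epsilon> U \<longrightarrow> diff X U \<epsilon> Fin X)"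
  proof
    assume "U = empty \<or> (\<exists>F. F \<epsilon> Fin X \<and> U = diff X F)"
    then show "U \<sqsubseteq> X \<and> (\<forall>x. x \<epsilon> U \<longrightarrow> diff X U \<epsilon> Fin X)"
      using diff_diff_cancel mem_Fin by (auto simp: subset_def)
  next
    assume U: "U \<sqsubseteq> X \<and> (\<forall>x. x \<epsilon> U \<longrightarrow> diff X U \<epsilon> Fin X)"
    then have "U = diff X (diff X U)" using diff_diff_cancel by simp
    then show "U = empty \<or> (\<exists>F. F \<epsilon> Fin X \<and> U = diff X F)" using U ex_mem_if_not_empty by blast
  qed
  finally show ?thesis .
qed

text \<open>Only sets containing \<open>p\<close> carry a condition: the others are subsets of
  \<open>X\<close>, while a set containing \<open>p\<close> is open exactly when its complement is a
  finite subset of \<open>X\<close>.\<close>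

lemma mem_infinity_topology:
  assumes "\<not> p \<epsilon> X"
  shows "U \<epsilon> infinity_topology X p \<longleftrightarrow>
    U \<sqsubseteq> adjoin X p \<and> (p \<epsilon> U \<longrightarrow> diff (adjoin X p) U \<epsilon> Fin X)"
proof -
  have d: "definable_fun (\<lambda>s. diff (adjoin X p) (s 0))" by (intro definability)
  have "U \<epsilon> infinity_topology X p \<longleftrightarrow> U \<sqsubseteq> X \<or> (\<exists>F. F \<epsilon> Fin X \<and> U = diff (adjoin X p) F)"
    unfolding infinity_topology_def
    by (simp add: mem_the_set[OF replacement_definable[OF d]])
  also have "\<dots> \<longleftrightarrow> U \<sqsubseteq> adjoin X p \<and> (p \<epsilon> U \<longrightarrow> diff (adjoin X p) U \<epsilon> Fin X)"
  proof
    assume "U \<sqsubseteq> X \<or> (\<exists>F. F \<epsilon> Fin X \<and> U = diff (adjoin X p) F)"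
    then show "U \<sqsubseteq> adjoin X p \<and> (p \<epsilon> U \<longrightarrow> diff (adjoin X p) U \<epsilon> Fin X)"
    proof
      assume "\<exists>F. F \<epsilon> Fin X \<and> U = diff (adjoin X p) F"
      then obtain F where F: "F \<epsilon> Fin X" "U = diff (adjoin X p) F" by blast
      then have "F \<sqsubseteq> adjoin X p" by (simp add: mem_Fin subset_def)
      then show ?thesis using F diff_diff_cancel by (simp add: subset_def)
    qed (use assms in \<open>auto simp: subset_def\<close>)
  next
    assume U: "U \<sqsubseteq> adjoin X p \<and> (p \<epsilon> U \<longrightarrow> diff (adjoin X p) U \<epsilon> Fin X)"
    then have "U = diff (adjoin X p) (diff (adjoin X p) U)" using diff_diff_cancel by simp
    then show "U \<sqsubseteq> X \<or> (\<exists>F. F \<epsilon> Fin X \<and> U = diff (adjoin X p) F)"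
      using U by (cases "p \<epsilon> U") (auto simp: subset_def)
  qed
  finally show ?thesis .
qed

text \<open>The set \<open>A\<close> covers all but finitely many points of \<open>B\<close>, and
  those are covered by finitely many further members.\<close>

lemma countable_subcover_if_cofinite:
  assumes "A \<epsilon> \<G>" and "finite_set (diff B A)" and "B \<sqsubseteq> bigunion \<G>"
  shows "\<exists>\<H>. \<H> \<sqsubseteq> \<G> \<and> countable_set \<H> \<and> B \<sqsubseteq> bigunion \<H>"
proof -
  have "diff B A \<sqsubseteq> bigunion \<G>" using assms(3) by (simp add: subset_def)
  then obtain H where H: "H \<sqsubseteq> \<G>" "finite_set H" "diff B A \<sqsubseteq> bigunion H"
    using finite_subcover[OF assms(2)] by blast
  have "adjoin H A \<sqsubseteq> \<G>" "B \<sqsubseteq> bigunion (adjoin H A)"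
    using H assms(1) unfolding subset_def by auto
  then show ?thesis using finite_set_countable[OF finite_set_adjoin[OF H(2)]] by blast
qed

section \<open>P-space and Lindelof properties of the two spaces\<close>

lemma topological_space_cofinite: "topological_space X (cofinite_topology X)"
  unfolding topological_space_def
proof (intro conjI allI impI)
  show "cofinite_topology X \<sqsubseteq> powerset X"
    by (rule subsetI) (simp add: mem_cofinite_topology)
  show "empty \<epsilon> cofinite_topology X"
    by (simp add: mem_cofinite_topology subset_def)
  have "diff X X = empty" by (intro ext) simp
  then show "X \<epsilon> cofinite_topology X"
    by (simp add: mem_cofinite_topology subset_def Fin_empty)
next
  fix U V assume UV: "U \<epsilon> cofinite_topology X \<and> V \<epsilon> cofinite_topology X"
  have "diff X (inter U V) = union (diff X U) (diff X V)" by (intro ext) auto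
  then show "inter U V \<epsilon> cofinite_topology X"
    using UV Fin_union by (auto simp: mem_cofinite_topology subset_def)
next
  fix S assume S: "S \<sqsubseteq> cofinite_topology X"
  have "diff X (bigunion S) \<epsilon> Fin X" if x: "x \<epsilon> bigunion S" for x
  proof -
    obtain U where U: "U \<epsilon> S" "x \<epsilon> U" using x by auto
    then have "diff X U \<epsilon> Fin X" using subsetD[OF S] mem_cofinite_topology by blast
    then show ?thesis by (rule Fin_subset) (use U in \<open>auto simp: subset_def\<close>)
  qed
  moreover have "bigunion S \<sqsubseteq> X"
    using subsetD[OF S] unfolding mem_cofinite_topology by (auto simp: subset_def)
  ultimately show "bigunion S \<epsilon> cofinite_topology X" unfolding mem_cofinite_topology by blast
qed

lemma topological_space_infinity:
  assumes p: "\<not> p \<epsilon> X"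
  shows "topological_space (adjoin X p) (infinity_topology X p)"
  unfolding topological_space_def
proof (intro conjI allI impI)
  note mem = mem_infinity_topology[OF p]
  show "infinity_topology X p \<sqsubseteq> powerset (adjoin X p)"
    by (rule subsetI) (simp add: mem)
  show "empty \<epsilon> infinity_topology X p"
    by (simp add: mem subset_def)
  have "diff (adjoin X p) (adjoin X p) = empty" by (intro ext) auto
  then show "adjoin X p \<epsilon> infinity_topology X p"
    by (simp add: mem subset_def Fin_empty)
  fix U V assume UV: "U \<epsilon> infinity_topology X p \<and> V \<epsilon> infinity_topology X p"
  have "diff (adjoin X p) (inter U V) = union (diff (adjoin X p) U) (diff (adjoin X p) V)"
    by (intro ext) auto
  then show "inter U V \<epsilon> infinity_topology X p"
    using UV Fin_union by (auto simp: mem subset_def)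
next
  note mem = mem_infinity_topology[OF p]
  fix S assume S: "S \<sqsubseteq> infinity_topology X p"
  have "diff (adjoin X p) (bigunion S) \<epsilon> Fin X" if x: "p \<epsilon> bigunion S"
  proof -
    obtain U where U: "U \<epsilon> S" "p \<epsilon> U" using x by auto
    then have "diff (adjoin X p) U \<epsilon> Fin X" using subsetD[OF S] mem by blast
    then show ?thesis by (rule Fin_subset) (use U in \<open>auto simp: subset_def\<close>)
  qed
  moreover have "bigunion S \<sqsubseteq> adjoin X p"
    using subsetD[OF S] unfolding mem by (auto simp: subset_def)
  ultimately show "bigunion S \<epsilon> infinity_topology X p" unfolding mem by blast
qed

text \<open>A point of the intersection lies in every member of the family, so each member is
  nonempty and has a finite complement; the union of these complements is then finite.\<close>

lemma P_space_cofinite: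
  assumes "quasi_Dedekind_finite X"
  shows "P_space X (cofinite_topology X)"
  unfolding P_space_def
proof (intro conjI allI impI topological_space_cofinite)
  fix G assume "G_delta X (cofinite_topology X) G"
  then obtain S where S: "S \<sqsubseteq> cofinite_topology X" "countable_set S"
    and G: "G = (SET x. x \<epsilon> X \<and> (\<forall>U. U \<epsilon> S \<longrightarrow> x \<epsilon> U))"
    unfolding G_delta_def by blast
  have mem_G: "x \<epsilon> G \<longleftrightarrow> x \<epsilon> X \<and> (\<forall>U. U \<epsilon> S \<longrightarrow> x \<epsilon> U)" for x
    unfolding G by (rule mem_the_set[OF separation_definable]) (intro definability)
  have "diff X G \<epsilon> Fin X" if x: "x \<epsilon> G" for x
  proof -
    have "diff X U \<epsilon> Fin X" if U: "U \<epsilon> S" for U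
      using subsetD[OF S(1) U] x U unfolding mem_cofinite_topology mem_G by blast
    then obtain F where F: "F \<epsilon> Fin X" "\<And>x. x \<epsilon> F \<longleftrightarrow> x \<epsilon> X \<and> (\<exists>U. U \<epsilon> S \<and> \<not> x \<epsilon> U)"
      using Fin_countable_union_of_complements[OF assms S(2), of X] by blast
    have "diff X G = F" by (intro ext) (auto simp: F(2) mem_G)
    then show ?thesis using F(1) by simp
  qed
  then show "G \<epsilon> cofinite_topology X"
    unfolding mem_cofinite_topology using mem_G by (auto simp: subset_def)
qed

lemma P_space_infinity:
  assumes "quasi_Dedekind_finite X" and p: "\<not> p \<epsilon> X"
  shows "P_space (adjoin X p) (infinity_topology X p)"
  unfolding P_space_def
proof (intro conjI allI impI topological_space_infinity[OF p])
  note mem = mem_infinity_topology[OF p]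
  let ?Z = "adjoin X p"
  fix G assume "G_delta ?Z (infinity_topology X p) G"
  then obtain S where S: "S \<sqsubseteq> infinity_topology X p" "countable_set S"
    and G: "G = (SET x. x \<epsilon> ?Z \<and> (\<forall>U. U \<epsilon> S \<longrightarrow> x \<epsilon> U))"
    unfolding G_delta_def by blast
  have mem_G: "x \<epsilon> G \<longleftrightarrow> x \<epsilon> ?Z \<and> (\<forall>U. U \<epsilon> S \<longrightarrow> x \<epsilon> U)" for x
    unfolding G by (rule mem_the_set[OF separation_definable]) (intro definability)
  \<comment> \<open>As \<open>p\<close> lies in every member of the family, each complement is a
    finite subset of \<open>X\<close>.\<close>
  have "diff ?Z G \<epsilon> Fin X" if x: "p \<epsilon> G"
  proof -
    have "diff ?Z U \<epsilon> Fin X" if U: "U \<epsilon> S" for U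
      using subsetD[OF S(1) U] x U unfolding mem mem_G by blast
    then obtain F where F: "F \<epsilon> Fin X" "\<And>x. x \<epsilon> F \<longleftrightarrow> x \<epsilon> ?Z \<and> (\<exists>U. U \<epsilon> S \<and> \<not> x \<epsilon> U)"
      using Fin_countable_union_of_complements[OF assms(1) S(2), of ?Z] by blast
    have "diff ?Z G = F" by (intro ext) (use F(2) mem_G in auto)
    then show ?thesis using F(1) by simp
  qed
  then show "G \<epsilon> infinity_topology X p"
    unfolding mem using mem_G by (auto simp: subset_def)
qed

text \<open>The whole topology serves as the base: one nonempty member of a cover leaves only
  finitely many points.\<close>

lemma base_hereditarily_Lindelof_cofinite:
  "base_hereditarily_Lindelof X (cofinite_topology X)"
proof -
  let ?T = "cofinite_topology X"
  have "base ?T ?T"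
    unfolding base_def
  proof (intro conjI allI impI)
    fix U assume "U \<epsilon> ?T"
    moreover have "U = bigunion (upair U U)" by (intro ext) simp
    ultimately show "\<exists>S. S \<sqsubseteq> ?T \<and> U = bigunion S"
      by (intro exI[of _ "upair U U"]) (simp add: subset_def)
  qed (simp add: subset_def)
  moreover have "\<exists>\<H>. \<H> \<sqsubseteq> \<G> \<and> countable_set \<H> \<and> B \<sqsubseteq> bigunion \<H>"
    if B: "B \<epsilon> ?T" and \<G>: "\<G> \<sqsubseteq> ?T" "B \<sqsubseteq> bigunion \<G>" for B \<G>
  proof (cases "B = empty")
    case True
    then show ?thesis
      using finite_set_countable[OF finite_set_empty] by (auto simp: subset_def intro!: exI[of _ empty])
  next
    case False
    then obtain x A where A: "A \<epsilon> \<G>" "x \<epsilon> A"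
      using ex_mem_if_not_empty subsetD[OF \<G>(2)] by force
    then have "finite_set (diff X A)"
      using subsetD[OF \<G>(1)] unfolding mem_cofinite_topology mem_Fin by blast
    moreover have "diff B A \<sqsubseteq> diff X A"
      using B unfolding mem_cofinite_topology by (simp add: subset_def)
    ultimately show ?thesis
      using countable_subcover_if_cofinite[OF A(1) _ \<G>(2)] finite_set_subset by blast
  qed
  ultimately show ?thesis
    unfolding base_hereditarily_Lindelof_def using topological_space_cofinite by blast
qed

lemma base_hereditarily_Lindelof_infinity:
  assumes p: "\<not> p \<epsilon> X"
  shows "base_hereditarily_Lindelof (adjoin X p) (infinity_topology X p)"
proof -
  note mem = mem_infinity_topology[OF p]
  let ?T = "infinity_topology X p"
  \<comment> \<open>The whole topology would not do in general, since an uncountable subset of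
    \<open>X\<close> covered by its singletons has no countable subcover. With this base, a base set
    is either a singleton or contains \<open>p\<close>, and in the second case a cover has a member
    containing \<open>p\<close>, which is cofinite.\<close>
  define \<B> where "\<B> = sep ?T (\<lambda>B. p \<epsilon> B \<or> (\<exists>x. x \<epsilon> X \<and> B = upair x x))"
  have D: "definable (\<lambda>s. p \<epsilon> s 0 \<or> (\<exists>x. x \<epsilon> X \<and> s 0 = upair x x))" by (intro definability)
  have mem_\<B>: "B \<epsilon> \<B> \<longleftrightarrow> B \<epsilon> ?T \<and> (p \<epsilon> B \<or> (\<exists>x. x \<epsilon> X \<and> B = upair x x))" for B
    unfolding \<B>_def by (rule mem_sep[OF D])
  have sub: "\<B> \<sqsubseteq> ?T" unfolding \<B>_def by (rule sep_subset[OF D])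
  have single: "upair x x \<epsilon> \<B>" if x: "x \<epsilon> X" for x
    unfolding mem_\<B> mem using p x by (auto simp: subset_def)
  have "base ?T \<B>"
    unfolding base_def
  proof (intro conjI sub allI impI)
    fix U assume U: "U \<epsilon> ?T"
    have D: "definable (\<lambda>s. s 0 \<sqsubseteq> U)" by (intro definability)
    have "\<exists>B. B \<epsilon> \<B> \<and> B \<sqsubseteq> U \<and> x \<epsilon> B" if x: "x \<epsilon> U" for x
    proof (cases "p \<epsilon> U")
      case True
      then show ?thesis using U x mem_\<B> by (intro exI[of _ U]) (simp add: subset_def)
    next
      case False
      then have "x \<epsilon> X" using U x unfolding mem by (auto simp: subset_def)
      then show ?thesis using single x by (intro exI[of _ "upair x x"]) (simp add: subset_def)
    qed
    moreover have "B \<epsilon> sep \<B> (\<lambda>B. B \<sqsubseteq> U) \<longleftrightarrow> B \<epsilon> \<B> \<and> B \<sqsubseteq> U" for B by (rule mem_sep[OF D])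
    ultimately have "U = bigunion (sep \<B> (\<lambda>B. B \<sqsubseteq> U))"
      by (intro ext) (simp, blast dest: subsetD)
    then show "\<exists>S. S \<sqsubseteq> \<B> \<and> U = bigunion S" using sep_subset[OF D] by blast
  qed
  moreover have "\<exists>\<H>. \<H> \<sqsubseteq> \<G> \<and> countable_set \<H> \<and> B \<sqsubseteq> bigunion \<H>"
    if B: "B \<epsilon> \<B>" and \<G>: "\<G> \<sqsubseteq> \<B>" "B \<sqsubseteq> bigunion \<G>" for B \<G>
  proof (cases "p \<epsilon> B")
    case True
    then obtain A where A: "A \<epsilon> \<G>" "p \<epsilon> A" using subsetD[OF \<G>(2)] by force
    then have "finite_set (diff (adjoin X p) A)"
      using subsetD[OF \<G>(1)] unfolding mem_\<B> mem mem_Fin by blast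
    moreover have "diff B A \<sqsubseteq> diff (adjoin X p) A"
      using B unfolding mem_\<B> mem by (simp add: subset_def)
    ultimately show ?thesis
      using countable_subcover_if_cofinite[OF A(1) _ \<G>(2)] finite_set_subset by blast
  next
    case False
    then obtain x where x: "B = upair x x" using B mem_\<B> by blast
    then obtain A where A: "A \<epsilon> \<G>" "x \<epsilon> A" using subsetD[OF \<G>(2), of x] by auto
    then have "diff B A = empty" using x by (intro ext) auto
    then show ?thesis
      using countable_subcover_if_cofinite[OF A(1) _ \<G>(2)] finite_set_empty by simp
  qed
  ultimately show ?thesis
    unfolding base_hereditarily_Lindelof_def using topological_space_infinity[OF p] by blast
qed

end

theorem theorem5p14:
  fixes mem :: "'v \<Rightarrow> 'v \<Rightarrow> bool" (infix "\<epsilon>" 50)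
    and Y TY :: 'v
  assumes "ZF mem"
    and "membership.P_space mem Y TY"
  shows
    "(\<forall>X TX. membership.P_space mem X TX
        \<and> (\<forall>x. x \<epsilon> X \<longrightarrow> (\<exists>B. membership.neighborhood_base mem X TX x B
                                \<and> membership.well_orderable mem B))
        \<longrightarrow> membership.P_space mem (membership.product mem X Y)
              (membership.product_topology mem TX TY))
     \<and> (\<forall>X TX. membership.P_space mem X TX \<and> membership.first_countable_space mem X TX
        \<longrightarrow> membership.P_space mem (membership.product mem X Y)
              (membership.product_topology mem TX TY))
     \<and> (\<forall>X TX. membership.P_space mem X TX \<and> membership.base_hereditarily_Lindelof mem X TX
        \<longrightarrow> membership.P_space mem (membership.product mem X Y)
              (membership.product_topology mem TX TY))
     \<and> (\<forall>X p. \<not> membership.finite_set mem X \<and> membership.quasi_Dedekind_finite mem X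
          \<and> \<not> p \<epsilon> X
        \<longrightarrow> membership.P_space mem (membership.product mem X Y)
              (membership.product_topology mem (membership.cofinite_topology mem X) TY)
          \<and> membership.P_space mem (membership.product mem (membership.adjoin mem X p) Y)
              (membership.product_topology mem (membership.infinity_topology mem X p) TY))"
proof (intro conjI allI impI)
  interpret ZF mem by (rule assms(1))
  note Y = assms(2)
  fix X TX
  show "P_space (product X Y) (product_topology TX TY)"
    if "P_space X TX \<and> (\<forall>x. x \<epsilon> X \<longrightarrow> (\<exists>B. neighborhood_base X TX x B \<and> well_orderable B))"
    using P_space_product_well_orderable[OF _ Y] that by blast
  show "P_space (product X Y) (product_topology TX TY)"
    if "P_space X TX \<and> first_countable_space X TX"
    \<comment> \<open>Countable neighborhood bases are well-orderable, so this is an instance of the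
      previous case.\<close>
    using P_space_product_well_orderable[OF _ Y] that countable_set_well_orderable
    unfolding first_countable_space_def by blast
  show "P_space (product X Y) (product_topology TX TY)"
    if "P_space X TX \<and> base_hereditarily_Lindelof X TX"
    using P_space_product_base_hereditarily_Lindelof[OF _ Y] that by blast
next
  interpret ZF mem by (rule assms(1))
  fix X p
  assume "\<not> finite_set X \<and> quasi_Dedekind_finite X \<and> \<not> p \<epsilon> X"
  then have X: "quasi_Dedekind_finite X" and p: "\<not> p \<epsilon> X" by blast+
  show "P_space (product X Y) (product_topology (cofinite_topology X) TY)"
    using P_space_product_base_hereditarily_Lindelof[OF P_space_cofinite[OF X] assms(2)
        base_hereditarily_Lindelof_cofinite] .
  show "P_space (product (adjoin X p) Y) (product_topology (infinity_topology X p) TY)"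
    using P_space_product_base_hereditarily_Lindelof[OF P_space_infinity[OF X p] assms(2)
        base_hereditarily_Lindelof_infinity[OF p]] .
qed

end
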